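(* Let $f:\mathbb{R}^n\to\mathbb{R}^n$ and $h:\mathbb{R}^n\to\mathbb{R}^p$ be locally Lipschitz and let $\mathcal{O}\subset\mathbb{R}^n$ be open. Assume the system $\dot x=f(x)$, $y=h(x)$ is forward complete within $\mathcal{O}$. Assume also the existence of an integer $m$, a Hurwitz complex $m\times m$ matrix $A$, continuous functions $T_a:\mathrm{cl}(\mathcal{O})\to\mathbb{C}^{m\times p}$ and $B:\mathbb{R}^p\to\mathbb{C}^{m\times p}$, and a function $\rho$ of class $\mathcal{K}_\infty$ such that $$|x_1-x_2|\le\rho(|T_a(x_1)-T_a(x_2)|)\qquad\forall(x_1,x_2)\in\mathrm{cl}(\mathcal{O})^2,$$ the function $L_fT_a$ is well defined on $\mathcal{O}$, and the function $\mathfrak{E}:\mathrm{cl}(\mathcal{O})\to\mathbb{C}^{m\times p}$ defined as $$\mathfrak{E}(x)=L_fT_a(x)-[A\,T_a(x)+B(h(x))]\qquad\forall x\in\mathcal{O}$$ satisfies $$|\mathfrak{E}(x_1)-\mathfrak{E}(x_2)|\le N\,|T_a(x_1)-T_a(x_2)|\qquad\forall(x_1,x_2)\in\mathrm{cl}(\mathcal{O})^2,$$ where $N$ is a positive real number satisfying $2N\,\lambda_{\max}(P)<1$, with $\lambda_{\max}(P)$ the largest eigenvalue of the Hermitian matrix $P$ solution of $$\overline{A}^{\top}P+PA=-I .$$ Then there exist a function $T_a^*:\mathbb{C}^{m\times p}\to\mathrm{cl}(\mathcal{O})$ and a locally Lipschitz function $\mathfrak{F}:\mathbb{C}^{m\times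 p}\to\mathbb{C}^{m\times p}$ such that, for each $x\in\mathcal{O}$ and $z\in\mathbb{C}^{m\times p}$, each solution $(X(x,t),Z(x,z,t))$, with initial condition $(x,z)$ at $t=0$, of $$\dot x=f(x),\qquad\dot z=Az+\mathfrak{F}(z)+B(h(x))$$ is right maximally defined on $[0,\sigma^+_{\mathbb{R}^n}(x))$. Moreover, we have the implication $$\sigma^+_{\mathcal{O}}(x)=\sigma^+_{\mathbb{R}^n}(x)\ \Longrightarrow\ \lim_{t\to\sigma^+_{\mathbb{R}^n}(x)}\left|T_a^*(Z(x,z,t))-X(x,t)\right|=0 .$$
   Context: For $x\in\mathbb{R}^n$, $X(x,t)$ denotes the unique maximal solution of $\dot x=f(x)$ with initial condition $x$ at $t=0$. For an open set $\mathcal{O}$ and $x\in\mathcal{O}$, $(\sigma^-_{\mathcal{O}}(x),\sigma^+_{\mathcal{O}}(x))$ is the maximal interval (containing $0$) of definition of the solution $X(x,t)$ conditioned to take values in $\mathcal{O}$; in particular $(\sigma^-_{\mathbb{R}^n}(x),\sigma^+_{\mathbb{R}^n}(x))$ is its maximal interval of definition. Forward completeness within $\mathcal{O}$: for each $x\in\mathcal{O}$, $\sigma^+_{\mathcal{O}}(x)<+\infty$ implies $\sigma^+_{\mathcal{O}}(x)<\sigma^+_{\mathbb{R}^n}(x)$. $\mathrm{cl}$ denotes closure. $L_fT_a(x)=\lim_{\tau\to0}\frac{T_a(X(x,\tau))-T_a(x)}{\tau}$ is the Lie derivative of $T_a$ along $f$. A matrix is Hurwitz if all its eigenvalues have strictly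 negative real part. A class $\mathcal{K}_\infty$ function is a continuous, strictly increasing, unbounded function $\mathbb{R}_+\to\mathbb{R}_+$ vanishing at $0$. $|\cdot|$ is the Euclidean norm (Frobenius norm on $\mathbb{C}^{m\times p}$). *)

theory Defs
  imports "HOL-Analysis.Analysis"
begin

abbreviation locally_lipschitz :: "('a::metric_space \<Rightarrow> 'b::metric_space) \<Rightarrow> bool" where
  "locally_lipschitz f \<equiv> local_lipschitz (UNIV :: real set) UNIV (\<lambda>_. f)"

definition class_K_inf :: "(real \<Rightarrow> real) \<Rightarrow> bool" where
  "class_K_inf \<rho> \<longleftrightarrow> continuous_on {0..} \<rho> \<and> strict_mono_on {0..} \<rho> \<and>
     \<rho> 0 = 0 \<and> \<not> bdd_above (\<rho> ` {0..})"

definition solution_on ::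
  "('a::real_normed_vector \<Rightarrow> 'a) \<Rightarrow> 'a \<Rightarrow> real set \<Rightarrow> (real \<Rightarrow> 'a) \<Rightarrow> bool" where
  "solution_on f x J \<phi> \<longleftrightarrow> is_interval J \<and> 0 \<in> J \<and> \<phi> 0 = x \<and>
     (\<forall>t\<in>J. (\<phi> has_vector_derivative f (\<phi> t)) (at t within J))"

text \<open>The solution \<open>X(x,t)\<close>. For a locally Lipschitz \<open>f\<close> any two solutions through \<open>x\<close> agree
  on their common interval, so the description below is proper at each time \<open>t\<close> of the maximal
  interval of definition.\<close>

definition flow :: "('a::real_normed_vector \<Rightarrow> 'a) \<Rightarrow> 'a \<Rightarrow> real \<Rightarrow> 'a" where
  "flow f x t = (THE y. \<exists>J \<phi>. solution_on f x J \<phi> \<and> t \<in> J \<and> y = \<phi> t)"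

definition max_interval :: "('a::real_normed_vector \<Rightarrow> 'a) \<Rightarrow> 'a set \<Rightarrow> 'a \<Rightarrow> real set" where
  "max_interval f \<O> x = \<Union>{J. \<exists>\<phi>. solution_on f x J \<phi> \<and> \<phi> ` J \<subseteq> \<O>}"

definition sigma_plus :: "('a::real_normed_vector \<Rightarrow> 'a) \<Rightarrow> 'a set \<Rightarrow> 'a \<Rightarrow> ereal" where
  "sigma_plus f \<O> x = Sup (ereal ` max_interval f \<O> x)"

definition forward_complete_within :: "('a::real_normed_vector \<Rightarrow> 'a) \<Rightarrow> 'a set \<Rightarrow> bool" where
  "forward_complete_within f \<O> \<longleftrightarrow>
     (\<forall>x\<in>\<O>. sigma_plus f \<O> x < \<infinity> \<longrightarrow> sigma_plus f \<O> x < sigma_plus f UNIV x)"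

definition right_maximal_solution ::
  "('a::real_normed_vector \<Rightarrow> 'a) \<Rightarrow> 'a \<Rightarrow> ereal \<Rightarrow> (real \<Rightarrow> 'a) \<Rightarrow> bool" where
  "right_maximal_solution g w b \<phi> \<longleftrightarrow>
     0 < b \<and> solution_on g w {t. 0 \<le> t \<and> ereal t < b} \<phi> \<and>
     \<not> (\<exists>b' \<psi>. b < b' \<and> solution_on g w {t. 0 \<le> t \<and> ereal t < b'} \<psi> \<and>
           (\<forall>t. 0 \<le> t \<and> ereal t < b \<longrightarrow> \<psi> t = \<phi> t))"

definition has_lie_derivative ::
  "('a::real_normed_vector \<Rightarrow> 'a) \<Rightarrow> ('a \<Rightarrow> 'b::real_normed_vector) \<Rightarrow> 'a \<Rightarrow> 'b \<Rightarrow> bool" where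
  "has_lie_derivative f T x L \<longleftrightarrow> ((\<lambda>\<tau>. (T (flow f x \<tau>) - T x) /\<^sub>R \<tau>) \<longlongrightarrow> L) (at 0)"

definition lie_derivative ::
  "('a::real_normed_vector \<Rightarrow> 'a) \<Rightarrow> ('a \<Rightarrow> 'b::real_normed_vector) \<Rightarrow> 'a \<Rightarrow> 'b" where
  "lie_derivative f T x = Lim (at 0) (\<lambda>\<tau>. (T (flow f x \<tau>) - T x) /\<^sub>R \<tau>)"

definition eigenvalue :: "complex^'m^'m \<Rightarrow> complex \<Rightarrow> bool" where
  "eigenvalue M c \<longleftrightarrow> (\<exists>v. v \<noteq> 0 \<and> M *v v = c *s v)"

definition hurwitz :: "complex^'m^'m \<Rightarrow> bool" where
  "hurwitz M \<longleftrightarrow> (\<forall>c. eigenvalue M c \<longrightarrow> Re c < 0)"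

definition conj_transpose :: "complex^'n^'m \<Rightarrow> complex^'m^'n" where
  "conj_transpose M = (\<chi> i j. cnj (M $ j $ i))"

definition hermitian :: "complex^'m^'m \<Rightarrow> bool" where
  "hermitian M \<longleftrightarrow> conj_transpose M = M"

text \<open>Meant for Hermitian matrices only: their eigenvalues are all real.\<close>

definition lambda_max :: "complex^'m^'m \<Rightarrow> real" where
  "lambda_max M = Max {r. eigenvalue M (complex_of_real r)}"

end

(* The error map of the observer is E composed with the inverse of Ta on Ta (cl O), where it is
   N-Lipschitz; Kirszbraun's theorem extends it to a globally N-Lipschitz F without increasing the
   constant, and this is what makes the sharp condition 2 N lambda_max(P) < 1 usable. The Z-equation
   is then globally Lipschitz in Z, so Z lives as long as X does. If X never leaves O, the difference
   e = Z - Ta(X) satisfies e' = A e + F(Z) - F(Ta(X)), and (e, P e) decays exponentially because its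
   derivative is at most -(1 - 2 N lambda_max(P)) |e|^2. The map Tstar sends z to a point of cl O
   whose image under Ta is nearest to z, so that |Tstar(Z) - X| <= rho(2 |e|). *)
theory Submission
  imports Defs "HOL-Computational_Algebra.Fundamental_Theorem_Algebra"
begin

section \<open>Extension of Lipschitz maps between Euclidean spaces\<close>

text \<open>Three points lie behind the argument. (1) \<open>P\<close> is given only as a Hermitian
  solution of the Lyapunov equation, so its positivity has to come from \<open>hurwitz A\<close>.
  Instead of writing \<open>P\<close> as an integral of matrix exponentials, the proof stays
  algebraic: every vector is annihilated by a product of factors A - l I with l an eigenvalue of A,
  and induction over such products gives 0 < (v, P v) for nonzero v. Hence (e, P e) is comparable to
  |e|^2 from both sides. (2) By the definition of \<open>E\<close>, the curve Ta(X) solves the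
  Z-equation itself while X stays in \<O>; this is why \<open>B\<close> and \<open>h\<close> cancel
  from the equation of e. The Lie derivative is known only pointwise along trajectories, so the
  decay is read off a differential inequality, not an integral formula. (3) Forward completeness
  turns equality of the two exit times into both being infinite, so exponential decay in time is
  decay towards the end of the interval.\<close>

lemma sum_weighted_dist_sq:
  fixes t :: "'i \<Rightarrow> 'a::real_inner"
  assumes "sum u S = (1::real)"
  shows "(\<Sum>i\<in>S. \<Sum>j\<in>S. u i * u j * (norm (t i - t j))\<^sup>2)
    = 2 * (\<Sum>i\<in>S. u i * (norm (t i))\<^sup>2) - 2 * (norm (\<Sum>i\<in>S. u i *\<^sub>R t i))\<^sup>2"
proof -
  have inner: "(norm (\<Sum>i\<in>S. u i *\<^sub>R t i))\<^sup>2 = (\<Sum>i\<in>S. \<Sum>j\<in>S. u i * u j * (t i \<bullet> t j))"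
    by (simp add: power2_norm_eq_inner inner_sum_left inner_sum_right sum_distrib_left mult_ac
        inner_commute)
  have left: "(\<Sum>i\<in>S. \<Sum>j\<in>S. u i * u j * (norm (t i))\<^sup>2) = (\<Sum>i\<in>S. u i * (norm (t i))\<^sup>2)"
  proof -
    have "(\<Sum>i\<in>S. \<Sum>j\<in>S. u i * u j * (norm (t i))\<^sup>2) = (\<Sum>i\<in>S. u i * (norm (t i))\<^sup>2 * sum u S)"
      unfolding sum_distrib_left by (intro sum.cong refl) simp
    then show ?thesis by (simp add: assms)
  qed
  have right: "(\<Sum>i\<in>S. \<Sum>j\<in>S. u i * u j * (norm (t j))\<^sup>2) = (\<Sum>i\<in>S. u i * (norm (t i))\<^sup>2)"
    unfolding left[symmetric] by (subst sum.swap, intro sum.cong refl) simp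
  have "u i * u j * (norm (t i - t j))\<^sup>2 =
      u i * u j * (norm (t i))\<^sup>2 + u i * u j * (norm (t j))\<^sup>2 - 2 * (u i * u j * (t i \<bullet> t j))" for i j
    by (simp add: power2_norm_eq_inner inner_diff_left inner_diff_right inner_commute algebra_simps)
  then show ?thesis
    by (simp add: sum.distrib sum_subtractf left right inner flip: sum_distrib_left)
qed

text \<open>The common point of the balls is found by duality: with weights \<open>c\<close> on \<open>G\<close> and
  \<open>y = \<Sum> c t\<close>, a maximiser of the concave function
  \<open>\<Sum> c (\<bar>t\<bar>\<^sup>2 - N\<^sup>2 \<bar>x - s\<bar>\<^sup>2) - \<bar>y\<bar>\<^sup>2\<close> has a nonpositive value there and the optimality
  conditions say that \<open>y\<close> lies in every ball.\<close>

lemma Kirszbraun_finite: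
  fixes G :: "('a::real_inner \<times> 'b::real_inner) set"
  assumes "finite G" and "0 \<le> N"
    and lip: "\<And>s t s' t'. (s, t) \<in> G \<Longrightarrow> (s', t') \<in> G \<Longrightarrow> norm (t - t') \<le> N * norm (s - s')"
  shows "\<exists>y. \<forall>(s, t)\<in>G. norm (y - t) \<le> N * norm (x - s)"
proof (cases "G = {}")
  case False
  define \<alpha> where "\<alpha> s t = (norm t)\<^sup>2 - N\<^sup>2 * (norm (s - x))\<^sup>2" for s :: 'a and t :: 'b
  \<comment> \<open>Weights on \<open>G\<close> become points of a convex hull: the second component
    is y and the third the linear part of the dual function, so \<open>D\<close> is that function.
    The first component keeps \<open>s - x\<close> readable from a point of
    \<open>S\<close>.\<close>
  define S where "S = (\<lambda>(s, t). (s - x, t, \<alpha> s t)) ` G"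
  define D where "D q = snd (snd q) - (norm (fst (snd q)))\<^sup>2" for q :: "'a \<times> 'b \<times> real"
  have "finite S" using assms by (simp add: S_def)
  then have "compact (convex hull S)" by (rule finite_imp_compact_convex_hull)
  moreover have "convex hull S \<noteq> {}" using False by (simp add: S_def)
  moreover have "continuous_on (convex hull S) D"
    unfolding D_def by (intro continuous_intros)
  ultimately have "\<exists>q\<in>convex hull S. \<forall>p\<in>convex hull S. D p \<le> D q"
    by (rule continuous_attains_sup)
  then obtain q where q: "q \<in> convex hull S" and max: "\<And>p. p \<in> convex hull S \<Longrightarrow> D p \<le> D q"
    by blast
  define y a where "y = fst (snd q)" and "a = snd (snd q)"
  obtain c where c: "\<And>p. p \<in> S \<Longrightarrow> 0 \<le> c p" "sum c S = 1" "(\<Sum>p\<in>S. c p *\<^sub>R p) = q"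
    using q convex_hull_finite[OF \<open>finite S\<close>] by auto
  have y: "y = (\<Sum>p\<in>S. c p *\<^sub>R fst (snd p))" and a: "a = (\<Sum>p\<in>S. c p * snd (snd p))"
    by (simp_all add: y_def a_def c(3)[symmetric] fst_sum snd_sum)
  have "a - (norm y)\<^sup>2 \<le> 0"
  proof -
    have "snd (snd p) = (norm (fst (snd p)))\<^sup>2 - N\<^sup>2 * (norm (fst p))\<^sup>2" if "p \<in> S" for p
      using that by (auto simp: S_def \<alpha>_def)
    then have "a = (\<Sum>p\<in>S. c p * ((norm (fst (snd p)))\<^sup>2 - N\<^sup>2 * (norm (fst p))\<^sup>2))"
      unfolding a by (intro sum.cong) auto
    then have a': "a = (\<Sum>p\<in>S. c p * (norm (fst (snd p)))\<^sup>2) - N\<^sup>2 * (\<Sum>p\<in>S. c p * (norm (fst p))\<^sup>2)"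
      by (simp add: algebra_simps sum_subtractf sum_distrib_left)
    have "(\<Sum>p\<in>S. \<Sum>p'\<in>S. c p * c p' * (norm (fst (snd p) - fst (snd p')))\<^sup>2)
        \<le> (\<Sum>p\<in>S. \<Sum>p'\<in>S. N\<^sup>2 * (c p * c p' * (norm (fst p - fst p'))\<^sup>2))"
    proof (intro sum_mono)
      fix p p' assume p: "p \<in> S" "p' \<in> S"
      have "norm (fst (snd p) - fst (snd p')) \<le> N * norm (fst p - fst p')"
        using p lip by (auto simp: S_def)
      then have "(norm (fst (snd p) - fst (snd p')))\<^sup>2 \<le> N\<^sup>2 * (norm (fst p - fst p'))\<^sup>2"
        by (metis norm_ge_zero power_mono power_mult_distrib)
      then show "c p * c p' * (norm (fst (snd p) - fst (snd p')))\<^sup>2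
          \<le> N\<^sup>2 * (c p * c p' * (norm (fst p - fst p'))\<^sup>2)"
        using mult_left_mono[of _ _ "c p * c p'"] c(1)[OF p(1)] c(1)[OF p(2)]
        by (simp add: mult.left_commute)
    qed
    also have "\<dots> = N\<^sup>2 * (\<Sum>p\<in>S. \<Sum>p'\<in>S. c p * c p' * (norm (fst p - fst p'))\<^sup>2)"
      by (simp add: sum_distrib_left)
    \<comment> \<open>Twice a - |y|^2 is the weighted sum of squared distances in the target minus 2
      N^2 times the second moment of the sources about x. The Lipschitz bound passes to source
      distances, and the variance identity then leaves only the mean of the sources.\<close>
    finally have "a - (norm y)\<^sup>2 \<le> - (N\<^sup>2 * (norm (\<Sum>p\<in>S. c p *\<^sub>R fst p))\<^sup>2)"
      unfolding sum_weighted_dist_sq[OF c(2)] a' y by (simp add: algebra_simps)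
    also have "\<dots> \<le> 0" by simp
    finally show ?thesis .
  qed
  moreover have "(norm (y - t))\<^sup>2 - N\<^sup>2 * (norm (x - s))\<^sup>2 \<le> a - (norm y)\<^sup>2" if st: "(s, t) \<in> G" for s t
  proof -
    \<comment> \<open>\<open>d\<close> is the one-sided derivative of \<open>D\<close> at
      \<open>q\<close> towards the vertex of \<open>(s, t)\<close>; maximality forces
      \<open>d \<le> 0\<close>, which rearranges to the claim.\<close>
    define d where "d = \<alpha> s t - a - 2 * (y \<bullet> (t - y))"
    have "d \<le> \<epsilon> * (norm (t - y))\<^sup>2" if \<epsilon>: "0 < \<epsilon>" "\<epsilon> \<le> 1" for \<epsilon>
    proof -
      define p where "p = (1 - \<epsilon>) *\<^sub>R q + \<epsilon> *\<^sub>R (s - x, t, \<alpha> s t)"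
      have "(s - x, t, \<alpha> s t) \<in> convex hull S"
        using st by (intro hull_inc) (auto simp: S_def)
      then have "p \<in> convex hull S"
        using q \<epsilon> unfolding p_def by (intro convexD_alt) auto
      then have "D p \<le> D q" by (rule max)
      moreover have "fst (snd p) = y + \<epsilon> *\<^sub>R (t - y)" "snd (snd p) = a + \<epsilon> * (\<alpha> s t - a)"
        by (simp_all add: p_def y_def a_def algebra_simps)
      ultimately have "\<epsilon> * (\<alpha> s t - a) \<le> (norm (y + \<epsilon> *\<^sub>R (t - y)))\<^sup>2 - (norm y)\<^sup>2"
        by (simp add: D_def flip: y_def a_def)
      also have "\<dots> = \<epsilon> * (2 * (y \<bullet> (t - y)) + \<epsilon> * (norm (t - y))\<^sup>2)"
        by (simp only: power2_norm_eq_inner inner_add_left inner_add_right inner_scaleR_left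
            inner_scaleR_right) (simp add: inner_commute algebra_simps)
      finally have "\<alpha> s t - a \<le> 2 * (y \<bullet> (t - y)) + \<epsilon> * (norm (t - y))\<^sup>2"
        using \<epsilon> by simp
      then show ?thesis by (simp add: d_def)
    qed
    then have "\<forall>\<^sub>F \<epsilon> in at_right 0. d \<le> \<epsilon> * (norm (t - y))\<^sup>2"
      unfolding eventually_at_right_field by (intro exI[of _ 1]) auto
    moreover have "((\<lambda>\<epsilon>. \<epsilon> * (norm (t - y))\<^sup>2) \<longlongrightarrow> 0 * (norm (t - y))\<^sup>2) (at_right 0)"
      by (intro tendsto_intros)
    ultimately have "d \<le> 0"
      using tendsto_lowerbound[of _ "0 * (norm (t - y))\<^sup>2" "at_right (0::real)" d] by simp
    then show ?thesis
      unfolding d_def \<alpha>_def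
      by (simp add: power2_norm_eq_inner inner_diff_left inner_diff_right inner_commute norm_minus_commute algebra_simps)
  qed
  ultimately have "(norm (y - t))\<^sup>2 - N\<^sup>2 * (norm (x - s))\<^sup>2 \<le> 0" if "(s, t) \<in> G" for s t
    using that order_trans by blast
  then have "(norm (y - t))\<^sup>2 \<le> (N * norm (x - s))\<^sup>2" if "(s, t) \<in> G" for s t
    using that by (simp add: power_mult_distrib)
  then have "norm (y - t) \<le> N * norm (x - s)" if "(s, t) \<in> G" for s t
    using that \<open>0 \<le> N\<close> by (meson power2_le_imp_le mult_nonneg_nonneg norm_ge_zero)
  then show ?thesis by blast
qed simp

text \<open>The finite case gives the finite intersection property of the balls, and in a
  finite-dimensional target the ball of a single point \<open>p0\<close> is compact.\<close>

lemma Kirszbraun_point: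
  fixes G :: "('a::real_inner \<times> 'b::euclidean_space) set"
  assumes "0 \<le> N"
    and lip: "\<And>s t s' t'. (s, t) \<in> G \<Longrightarrow> (s', t') \<in> G \<Longrightarrow> norm (t - t') \<le> N * norm (s - s')"
  shows "\<exists>y. \<forall>(s, t)\<in>G. norm (y - t) \<le> N * norm (x - s)"
proof (cases "G = {}")
  case False
  then obtain p0 where p0: "p0 \<in> G" by blast
  define C where "C p = cball (snd p) (N * norm (x - fst p))" for p :: "'a \<times> 'b"
  have "C p0 \<inter> \<Inter> (C ` G) \<noteq> {}"
  proof (rule compact_imp_fip)
    show "compact (C p0)" by (simp add: C_def)
    show "closed T" if "T \<in> C ` G" for T using that by (auto simp: C_def)
    fix \<F> assume "finite \<F>" "\<F> \<subseteq> C ` G"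
    then obtain H where H: "finite H" "H \<subseteq> G" "\<F> = C ` H"
      by (meson finite_subset_image)
    obtain y where "\<forall>(s, t)\<in>insert p0 H. norm (y - t) \<le> N * norm (x - s)"
      using Kirszbraun_finite[of "insert p0 H" N x] H p0 assms by blast
    then have "y \<in> C p0 \<inter> \<Inter> \<F>"
      unfolding H(3) by (auto simp: C_def dist_norm norm_minus_commute)
    then show "C p0 \<inter> \<Inter> \<F> \<noteq> {}" by blast
  qed
  then obtain y where "\<And>p. p \<in> G \<Longrightarrow> y \<in> C p" by blast
  then have "norm (y - t) \<le> N * norm (x - s)" if "(s, t) \<in> G" for s t
    using that by (force simp: C_def dist_norm norm_minus_commute)
  then show ?thesis by blast
qed simp

theorem Kirszbraun:
  fixes f :: "'a::real_inner \<Rightarrow> 'b::euclidean_space"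
  assumes f: "N-lipschitz_on S f"
  obtains F where "N-lipschitz_on UNIV F" and "\<And>x. x \<in> S \<Longrightarrow> F x = f x"
proof -
  have N: "0 \<le> N" using f by (rule lipschitz_on_nonneg)
  \<comment> \<open>Zorn's lemma is applied to relations instead of partial functions:
    \<open>lip\<close> already makes \<open>G\<close> single-valued, since \<open>s = s'\<close>
    forces \<open>t = t'\<close>.\<close>
  define lip where "lip G \<longleftrightarrow> (\<forall>(s, t)\<in>G. \<forall>(s', t')\<in>G. norm (t - t') \<le> N * norm (s - s'))"
    for G :: "('a \<times> 'b) set"
  define G0 where "G0 = (\<lambda>x. (x, f x)) ` S"
  have "lip G0" using f by (auto simp: lip_def G0_def lipschitz_on_def dist_norm)
  have "\<exists>M\<in>{G. G0 \<subseteq> G \<and> lip G}. \<forall>G\<in>{G. G0 \<subseteq> G \<and> lip G}. M \<subseteq> G \<longrightarrow> G = M"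
  proof (rule subset_Zorn)
    fix \<C> assume C: "subset.chain {G. G0 \<subseteq> G \<and> lip G} \<C>"
    show "\<exists>U\<in>{G. G0 \<subseteq> G \<and> lip G}. \<forall>X\<in>\<C>. X \<subseteq> U"
    proof (cases "\<C> = {}")
      case True
      then show ?thesis using \<open>lip G0\<close> by blast
    next
      case False
      have "lip (\<Union>\<C>)"
        unfolding lip_def
      proof clarify
        fix s t X s' t' Y assume *: "(s, t) \<in> X" "X \<in> \<C>" "(s', t') \<in> Y" "Y \<in> \<C>"
        then obtain Z where "Z \<in> \<C>" "(s, t) \<in> Z" "(s', t') \<in> Z"
          using C unfolding subset_chain_def by (metis subset_iff)
        moreover have "lip Z" using C \<open>Z \<in> \<C>\<close> unfolding subset_chain_def by auto
        ultimately show "norm (t - t') \<le> N * norm (s - s')" unfolding lip_def by blast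
      qed
      moreover have "G0 \<subseteq> \<Union>\<C>" using C False unfolding subset_chain_def by blast
      ultimately show ?thesis by blast
    qed
  qed
  then obtain M where M: "G0 \<subseteq> M" "lip M"
    and maxi: "\<forall>G\<in>{G. G0 \<subseteq> G \<and> lip G}. M \<subseteq> G \<longrightarrow> G = M"
    by (elim bexE) blast
  have max: "G = M" if "lip G" "M \<subseteq> G" for G
    using maxi that M(1) by simp
  have "\<exists>y. (x, y) \<in> M" for x
  proof -
    obtain y where y: "\<forall>(s, t)\<in>M. norm (y - t) \<le> N * norm (x - s)"
      using Kirszbraun_point[OF N, of M x] M(2) unfolding lip_def by blast
    have "lip (insert (x, y) M)"
      using M(2) y unfolding lip_def by (fastforce simp: norm_minus_commute)
    then have "insert (x, y) M = M" by (rule max) blast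
    then show ?thesis by blast
  qed
  then obtain F where F: "\<And>x. (x, F x) \<in> M" by metis
  have *: "norm (F s - t) \<le> N * norm (s' - s)" if "(s', t) \<in> M" for s s' t
    using M(2) F that unfolding lip_def by (fastforce simp: norm_minus_commute)
  show thesis
  proof
    show "N-lipschitz_on UNIV F"
      using *[OF F] N by (auto simp: lipschitz_on_def dist_norm norm_minus_commute)
    show "F x = f x" if "x \<in> S" for x
      using *[of x "f x" x] that M(1) by (auto simp: G0_def)
  qed
qed

section \<open>Differential equations\<close>

text \<open>Gronwall in differential form: multiplying by exp(-k (t - a)) turns the inequality into
  monotonicity. As \<open>k\<close> may have either sign, this serves both uniqueness
  (\<open>k = 2 * L\<close>) and decay (\<open>k = - c\<close>).\<close>

lemma exponential_bound:
  fixes V :: "real \<Rightarrow> real"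
  assumes "a \<le> b" and cont: "continuous_on {a..b} V"
    and deriv: "\<And>t. a < t \<Longrightarrow> t < b \<Longrightarrow> \<exists>D. (V has_real_derivative D) (at t) \<and> D \<le> k * V t"
  shows "V b \<le> V a * exp (k * (b - a))"
proof -
  define W where "W t = V t * exp (- k * (t - a))" for t
  have "W b \<le> W a"
  proof (rule DERIV_nonpos_imp_decreasing_open[OF \<open>a \<le> b\<close>])
    fix t assume "a < t" "t < b"
    then obtain D where D: "(V has_real_derivative D) (at t)" "D \<le> k * V t"
      using deriv by blast
    have "(W has_real_derivative (D - k * V t) * exp (- k * (t - a))) (at t)"
      unfolding W_def by (rule derivative_eq_intros D refl | simp add: algebra_simps)+
    moreover have "(D - k * V t) * exp (- k * (t - a)) \<le> 0"
      using D(2) by (simp add: mult_nonpos_nonneg)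
    ultimately show "\<exists>y. (W has_real_derivative y) (at t) \<and> y \<le> 0" by blast
  qed (use cont in \<open>auto simp: W_def intro!: continuous_intros\<close>)
  then have "V b * exp (- k * (b - a)) * exp (k * (b - a)) \<le> V a * exp (k * (b - a))"
    unfolding W_def by (intro mult_right_mono) auto
  then show ?thesis by (simp add: mult.assoc flip: exp_add)
qed

text \<open>The Gronwall argument runs on |w|^2, which is differentiable even where |w| is
  not.\<close>

lemma eq_0_if_derivative_bounded:
  fixes w :: "real \<Rightarrow> 'a::real_inner"
  assumes w: "\<And>t. t \<in> {a..b} \<Longrightarrow> (w has_vector_derivative w' t) (at t within {a..b})"
    and bound: "\<And>t. t \<in> {a..b} \<Longrightarrow> norm (w' t) \<le> L * norm (w t)"
    and "w a = 0" and t: "t \<in> {a..b}"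
  shows "w t = 0"
proof -
  have "w t \<bullet> w t \<le> w a \<bullet> w a * exp (2 * L * (t - a))"
  proof (rule exponential_bound)
    have "continuous_on {a..b} w"
      using w by (rule continuous_on_vector_derivative)
    then show "continuous_on {a..t} (\<lambda>s. w s \<bullet> w s)"
      by (intro continuous_intros) (use t in \<open>auto intro: continuous_on_subset\<close>)
  next
    fix s assume s: "a < s" "s < t"
    then have s': "s \<in> {a..b}" "at s within {a..b} = at s"
      using t by (auto simp: at_within_Icc_at)
    then have "(w has_derivative (\<lambda>x. x *\<^sub>R w' s)) (at s)"
      using w[OF s'(1)] by (simp add: has_vector_derivative_def)
    from has_derivative_inner[OF this this]
    have "((\<lambda>s. w s \<bullet> w s) has_real_derivative 2 * (w s \<bullet> w' s)) (at s)"
      by (rule has_derivative_imp_has_field_derivative) (simp add: inner_commute)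
    moreover have "w s \<bullet> w' s \<le> norm (w s) * (L * norm (w s))"
      using norm_cauchy_schwarz[of "w s" "w' s"] mult_left_mono[OF bound[OF s'(1)], of "norm (w s)"]
      by simp
    ultimately show "\<exists>D. ((\<lambda>s. w s \<bullet> w s) has_real_derivative D) (at s) \<and> D \<le> 2 * L * (w s \<bullet> w s)"
      by (force simp: dot_square_norm power2_eq_square mult_ac)
  qed (use t in auto)
  then have "w t \<bullet> w t \<le> 0" using \<open>w a = 0\<close> by simp
  then show ?thesis by (simp add: dot_square_norm)
qed

lemma ode_unique:
  fixes u v :: "real \<Rightarrow> 'a::real_inner"
  assumes "\<And>t. t \<in> {a..b} \<Longrightarrow> (u has_vector_derivative F t (u t)) (at t within {a..b})"
    and "\<And>t. t \<in> {a..b} \<Longrightarrow> (v has_vector_derivative F t (v t)) (at t within {a..b})"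
    and "\<And>t. t \<in> {a..b} \<Longrightarrow> norm (F t (u t) - F t (v t)) \<le> L * norm (u t - v t)"
    and "u a = v a" and "t \<in> {a..b}"
  shows "u t = v t"
  using eq_0_if_derivative_bounded[of a b "\<lambda>t. u t - v t" "\<lambda>t. F t (u t) - F t (v t)" L t] assms
  by (auto intro: has_vector_derivative_diff)

section \<open>Restriction, translation, reversal and uniqueness of solutions\<close>

lemma solution_on_subset:
  assumes "solution_on f x J \<phi>" and "I \<subseteq> J" and "is_interval I" and "0 \<in> I"
  shows "solution_on f x I \<phi>"
  using assms unfolding solution_on_def
  by (meson has_vector_derivative_within_subset subset_iff)

lemma solution_on_continuous: "solution_on f x J \<phi> \<Longrightarrow> continuous_on J \<phi>"
  by (rule continuous_on_vector_derivative[of J \<phi> "\<lambda>t. f (\<phi> t)"]) (simp add: solution_on_def)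

lemma solution_on_Icc:
  assumes "solution_on f x J \<phi>" and "t \<in> J" and "0 \<le> t"
  shows "solution_on f x {0..t} \<phi>"
proof (rule solution_on_subset[OF assms(1)])
  show "{0..t} \<subseteq> J"
    using assms unfolding solution_on_def is_interval_1 by (meson atLeastAtMost_iff subsetI)
qed (use assms in \<open>auto simp: is_interval_cc\<close>)

text \<open>Lets the flow started at a point of a trajectory be read off the trajectory itself, as
  the Lie derivative at that point requires.\<close>

lemma solution_on_shift:
  assumes "solution_on f x J \<phi>" and "s \<in> J"
  shows "solution_on f (\<phi> s) ((\<lambda>t. t - s) ` J) (\<lambda>t. \<phi> (t + s))"
proof -
  have "((\<lambda>t. \<phi> (t + s)) has_vector_derivative f (\<phi> (t + s))) (at t within (\<lambda>t. t - s) ` J)"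
    if t: "t \<in> (\<lambda>t. t - s) ` J" for t
  proof -
    have "((\<lambda>t. t + s) has_vector_derivative 1) (at t within (\<lambda>t. t - s) ` J)"
      by (auto intro!: derivative_eq_intros)
    moreover have "(\<phi> has_vector_derivative f (\<phi> (t + s))) (at (t + s) within (\<lambda>t. t + s) ` (\<lambda>t. t - s) ` J)"
      using assms t by (auto simp: solution_on_def image_image)
    ultimately have "(\<phi> \<circ> (\<lambda>t. t + s) has_vector_derivative 1 *\<^sub>R f (\<phi> (t + s))) (at t within (\<lambda>t. t - s) ` J)"
      by (rule vector_diff_chain_within)
    then show ?thesis by (simp add: o_def)
  qed
  then show ?thesis
    using assms by (auto simp: solution_on_def image_iff is_interval_minus_translation)
qed

text \<open>Reduces uniqueness at negative times to uniqueness at positive times.\<close>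

lemma solution_on_reflect:
  assumes "solution_on f x J \<phi>"
  shows "solution_on (\<lambda>y. - f y) x (uminus ` J) (\<lambda>t. \<phi> (- t))"
proof -
  have "((\<lambda>t. \<phi> (- t)) has_vector_derivative - f (\<phi> (- t))) (at t within uminus ` J)"
    if t: "t \<in> uminus ` J" for t
  proof -
    have "(uminus has_vector_derivative - 1) (at t within uminus ` J)"
      by (auto intro!: derivative_eq_intros)
    moreover have "(\<phi> has_vector_derivative f (\<phi> (- t))) (at (- t) within uminus ` uminus ` J)"
      using assms t by (auto simp: solution_on_def image_image)
    ultimately have "(\<phi> \<circ> uminus has_vector_derivative (- 1) *\<^sub>R f (\<phi> (- t))) (at t within uminus ` J)"
      by (rule vector_diff_chain_within)
    then show ?thesis by (simp add: o_def)
  qed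
  then show ?thesis
    using assms by (auto simp: solution_on_def image_iff)
qed

lemma solution_unique_forward:
  fixes f :: "'a::euclidean_space \<Rightarrow> 'a"
  assumes f: "locally_lipschitz f"
    and \<phi>: "solution_on f x J \<phi>" and \<psi>: "solution_on f x J' \<psi>"
    and t: "t \<in> J" "t \<in> J'" "0 \<le> t"
  shows "\<phi> t = \<psi> t"
proof -
  note sol = solution_on_Icc[OF \<phi> t(1,3)] solution_on_Icc[OF \<psi> t(2,3)]
  \<comment> \<open>Over a compact time interval both trajectories stay in the compact set
    \<open>K\<close>, where one Lipschitz constant suffices. The time set \<open>{0}\<close> below
    is a dummy, as the family does not depend on time.\<close>
  define K where "K = \<phi> ` {0..t} \<union> \<psi> ` {0..t}"
  have "compact K"
    unfolding K_def
    by (intro compact_Un compact_continuous_image) (use sol solution_on_continuous in blast)+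
  moreover have "local_lipschitz {0 :: real} K (\<lambda>_. f)"
    using f by (rule local_lipschitz_subset) auto
  ultimately obtain L where L: "L-lipschitz_on K f"
    using local_lipschitz_compact_implies_lipschitz[where X = K and T = "{0 :: real}" and f = "\<lambda>_. f"] by auto
  show ?thesis
  proof (rule ode_unique[where F = "\<lambda>_. f" and a = 0 and b = t and L = L])
    show "norm (f (\<phi> s) - f (\<psi> s)) \<le> L * norm (\<phi> s - \<psi> s)" if "s \<in> {0..t}" for s
      using lipschitz_onD[OF L] that by (auto simp: K_def dist_norm)
    show "\<phi> 0 = \<psi> 0" using sol by (simp add: solution_on_def)
    show "t \<in> {0..t}" using t by simp
  qed (use sol in \<open>simp_all add: solution_on_def\<close>)
qed

lemma solution_unique:
  fixes f :: "'a::euclidean_space \<Rightarrow> 'a"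
  assumes f: "locally_lipschitz f"
    and \<phi>: "solution_on f x J \<phi>" and \<psi>: "solution_on f x J' \<psi>" and t: "t \<in> J" "t \<in> J'"
  shows "\<phi> t = \<psi> t"
proof (cases "0 \<le> t")
  case True
  then show ?thesis using solution_unique_forward assms by blast
next
  case False
  have "locally_lipschitz (\<lambda>y. - f y)"
    using f by (simp add: local_lipschitz_minus)
  from solution_unique_forward[OF this solution_on_reflect[OF \<phi>] solution_on_reflect[OF \<psi>], of "- t"]
  show ?thesis using False t by simp
qed

text \<open>Uniqueness makes the definite description in \<open>flow\<close> proper.\<close>

lemma flow_eq:
  fixes f :: "'a::euclidean_space \<Rightarrow> 'a"
  assumes "locally_lipschitz f" and "solution_on f x J \<phi>" and "t \<in> J"
  shows "flow f x t = \<phi> t"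
  unfolding flow_def
proof (rule the_equality)
  show "\<exists>J \<psi>. solution_on f x J \<psi> \<and> t \<in> J \<and> \<phi> t = \<psi> t"
    using assms by blast
  show "y = \<phi> t" if "\<exists>J \<psi>. solution_on f x J \<psi> \<and> t \<in> J \<and> y = \<psi> t" for y
    using that solution_unique[OF assms(1) _ assms(2) _ assms(3)] by auto
qed

section \<open>Existence on compact time intervals\<close>

lemma lipschitz_ode_exists:
  fixes G :: "'a::euclidean_space \<Rightarrow> 'a"
  assumes G: "L-lipschitz_on UNIV G" and \<beta>: "continuous_on {0..T} \<beta>" and "0 \<le> T"
  obtains u where "u 0 = u0"
    and "\<And>t. t \<in> {0..T} \<Longrightarrow> (u has_vector_derivative G (u t) + \<beta> t) (at t within {0..T})"
proof -
  \<comment> \<open>Adding 1 keeps \<open>k\<close> positive when \<open>L = 0\<close>.\<close>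
  define k where "k = L + 1"
  have k: "0 < k" using lipschitz_on_nonneg[OF G] by (simp add: k_def)
  have lip: "norm (G a - G b) \<le> k * norm (a - b)" for a b
    using lipschitz_onD[OF lipschitz_on_mono[OF G], of UNIV k a b] by (simp add: k_def dist_norm)
  have contG: "continuous_on UNIV G" using G by (rule lipschitz_on_continuous_on)
  \<comment> \<open>Picard iteration for the rescaled unknown v(t) = exp(-2 k t) u(t): in the
    supremum norm of v the map contracts on all of [0,T], however large T is.\<close>
  define H where "H v s = G (exp (2 * k * s) *\<^sub>R v s) + \<beta> s" for v :: "real \<Rightarrow> 'a" and s
  define \<Phi> where "\<Phi> v t = exp (- (2 * k * t)) *\<^sub>R (u0 + integral {0..t} (H v))" for v t
  have contH: "continuous_on {0..T} (H v)" if "continuous_on UNIV v" for v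
    unfolding H_def
    by (intro continuous_intros \<beta> continuous_on_compose2[OF contG] continuous_on_subset[OF that]) auto
  have deriv: "((\<lambda>t. integral {0..t} (H v)) has_vector_derivative H v t) (at t within {0..T})"
    if "continuous_on UNIV v" "t \<in> {0..T}" for v t
    by (rule integral_has_vector_derivative[OF contH]) (use that in auto)
  have "continuous_on (cbox 0 T) (\<Phi> v)" if "continuous_on UNIV v" for v
  proof -
    have "continuous_on {0..T} (\<lambda>t. integral {0..t} (H v))"
      using deriv[OF that] by (rule continuous_on_vector_derivative)
    then show ?thesis unfolding \<Phi>_def by (auto intro!: continuous_intros)
  qed
  \<comment> \<open>\<open>clamp\<close> freezes a function outside [0,T] and so gives a bounded
    continuous function on the whole line. These form a complete metric space that is a type, where
    Banach's fixed point theorem applies.\<close>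
  then have "\<exists>g :: real \<Rightarrow>\<^sub>C 'a. \<forall>x. g x = \<Phi> (apply_bcontfun v) (clamp 0 T x)" for v
    by (metis continuous_on_cbox_bcontfunE continuous_on_apply_bcontfun)
  then obtain S :: "(real \<Rightarrow>\<^sub>C 'a) \<Rightarrow> (real \<Rightarrow>\<^sub>C 'a)"
    where S: "\<And>v x. S v x = \<Phi> (apply_bcontfun v) (clamp 0 T x)" by metis
  have "dist (S v) (S w) \<le> 1 / 2 * dist v w" for v w
  proof (rule dist_bound)
    fix x
    define t where "t = clamp 0 T x"
    have t: "t \<in> {0..T}" using clamp_in_interval[of 0 T x] \<open>0 \<le> T\<close> by (simp add: t_def)
    have int: "H (apply_bcontfun v) integrable_on {0..t}" for v
      by (rule integrable_continuous_real, rule continuous_on_subset[OF contH]) (use t in auto)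
    \<comment> \<open>The integral of k exp(2 k s) over [0,t] is at most exp(2 k t) / 2; the
      prefactor in \<open>\<Phi>\<close> cancels the exponential, which leaves the contraction
      factor 1/2.\<close>
    have "((\<lambda>s. k * exp (2 * k * s) * dist v w) has_integral
        dist v w / 2 * exp (2 * k * t) - dist v w / 2 * exp (2 * k * 0)) {0..t}"
      using k t by (intro fundamental_theorem_of_calculus)
        (auto intro!: derivative_eq_intros simp flip: has_real_derivative_iff_has_vector_derivative)
    note bound_int = this
    have "norm (H v s - H w s) \<le> k * exp (2 * k * s) * dist v w" for s
    proof -
      have "norm (H v s - H w s) \<le> k * norm (exp (2 * k * s) *\<^sub>R v s - exp (2 * k * s) *\<^sub>R w s)"
        using lip by (simp add: H_def)
      also have "\<dots> = k * exp (2 * k * s) * dist (v s) (w s)"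
        by (simp add: dist_norm flip: scaleR_diff_right)
      also have "\<dots> \<le> k * exp (2 * k * s) * dist v w"
        using k by (intro mult_left_mono dist_bounded) auto
      finally show ?thesis .
    qed
    then have "norm (integral {0..t} (\<lambda>s. H v s - H w s)) \<le> integral {0..t} (\<lambda>s. k * exp (2 * k * s) * dist v w)"
      using bound_int by (intro integral_norm_bound_integral integrable_diff int) auto
    also have "\<dots> = dist v w / 2 * exp (2 * k * t) - dist v w / 2 * exp (2 * k * 0)"
      using bound_int by (rule integral_unique)
    also have "\<dots> \<le> dist v w / 2 * exp (2 * k * t)" by simp
    finally have *: "norm (integral {0..t} (H v) - integral {0..t} (H w)) \<le> dist v w / 2 * exp (2 * k * t)"
      using int by (simp add: integral_diff)
    have "dist (S v x) (S w x) = exp (- (2 * k * t)) * norm (integral {0..t} (H v) - integral {0..t} (H w))"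
      by (simp add: S \<Phi>_def dist_norm flip: t_def scaleR_diff_right)
    also have "\<dots> \<le> exp (- (2 * k * t)) * (dist v w / 2 * exp (2 * k * t))"
      using * by (intro mult_left_mono) auto
    also have "\<dots> = 1 / 2 * dist v w" by (simp add: exp_minus field_simps)
    finally show "dist (S v x) (S w x) \<le> 1 / 2 * dist v w" .
  qed
  then obtain v where v: "S v = v"
    using banach_fix_type[of "1 / 2" S] by auto
  define u where "u t = exp (2 * k * t) *\<^sub>R v t" for t
  have u: "u t = u0 + integral {0..t} (H v)" if "t \<in> {0..T}" for t
  proof -
    have "v t = \<Phi> v t" using S[of v t] that by (simp add: v)
    then show ?thesis by (simp add: u_def \<Phi>_def flip: exp_add)
  qed
  show thesis
  proof
    show "u 0 = u0" using u[of 0] \<open>0 \<le> T\<close> by simp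
    fix t assume t: "t \<in> {0..T}"
    have "((\<lambda>t. u0 + integral {0..t} (H v)) has_vector_derivative H v t) (at t within {0..T})"
      using deriv[OF _ t, of v] by (auto intro!: derivative_eq_intros)
    then have "(u has_vector_derivative H v t) (at t within {0..T})"
      by (rule has_vector_derivative_transform[OF t, rotated]) (use u in auto)
    then show "(u has_vector_derivative G (u t) + \<beta> t) (at t within {0..T})"
      by (simp add: H_def u_def)
  qed
qed

text \<open>Composing \<open>f\<close> with the projection onto a small ball makes it globally
  Lipschitz without changing it in the ball, and the solution of the modified equation stays in the
  ball for a short time.\<close>

lemma local_solution_exists:
  fixes f :: "'a::euclidean_space \<Rightarrow> 'a"
  assumes "locally_lipschitz f"
  shows "\<exists>T>0. \<exists>\<phi>. solution_on f x {0..T} \<phi>"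
proof -
  obtain r L where r: "0 < r" and L: "L-lipschitz_on (cball x r) f"
    using local_lipschitzE[OF assms, of 0 x] by (metis Int_UNIV_right UNIV_I centre_in_cball less_imp_le)
  define G where "G y = f (closest_point (cball x r) y)" for y
  have G: "L-lipschitz_on UNIV G"
  proof (rule lipschitz_onI)
    fix y z
    have cp: "closest_point (cball x r) w \<in> cball x r" for w
      using r by (intro closest_point_in_set) auto
    have "dist (G y) (G z) \<le> L * dist (closest_point (cball x r) y) (closest_point (cball x r) z)"
      unfolding G_def by (rule lipschitz_onD[OF L cp cp])
    also have "\<dots> \<le> L * dist y z"
      using r lipschitz_on_nonneg[OF L] by (intro mult_left_mono closest_point_lipschitz) auto
    finally show "dist (G y) (G z) \<le> L * dist y z" .
  qed (rule lipschitz_on_nonneg[OF L])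
  obtain \<phi> where \<phi>: "\<phi> 0 = x"
    "\<And>t. t \<in> {0..1} \<Longrightarrow> (\<phi> has_vector_derivative G (\<phi> t) + 0) (at t within {0..1})"
    using lipschitz_ode_exists[OF G, of 1 "\<lambda>_. 0" x] by auto
  have "continuous_on {0..1} \<phi>"
    using \<phi>(2) by (rule continuous_on_vector_derivative)
  then obtain d where d: "0 < d" "\<And>t. t \<in> {0..1} \<Longrightarrow> dist t 0 < d \<Longrightarrow> dist (\<phi> t) (\<phi> 0) < r"
    unfolding continuous_on_iff using r by (metis atLeastAtMost_iff order_refl zero_le_one)
  \<comment> \<open>Halved because the continuity estimate asks for a distance strictly below
    \<open>d\<close>.\<close>
  define T where "T = min 1 (d / 2)"
  have "solution_on f x {0..T} \<phi>"
    unfolding solution_on_def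
  proof (intro conjI ballI)
    fix t assume "t \<in> {0..T}"
    then have t: "t \<in> {0..1}" "dist t 0 < d" using d(1) by (auto simp: T_def)
    then have "\<phi> t \<in> cball x r" using d(2) \<phi>(1) by (simp add: dist_commute less_imp_le)
    then have "G (\<phi> t) = f (\<phi> t)" by (simp add: G_def closest_point_self)
    then show "(\<phi> has_vector_derivative f (\<phi> t)) (at t within {0..T})"
      using has_vector_derivative_within_subset[OF \<phi>(2)[OF t(1)], of "{0..T}"] by (simp add: T_def)
  qed (use d(1) \<phi>(1) in \<open>auto simp: T_def is_interval_cc\<close>)
  moreover have "0 < T" using d(1) by (simp add: T_def)
  ultimately show ?thesis by blast
qed

text \<open>The interval [0,b) for finite and infinite \<open>b\<close> alike, empty for b \<le> 0.
  It is literally the time set in \<open>right_maximal_solution\<close>, so folding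
  \<open>before_def\<close> brings that definition into this notation.\<close>

definition before :: "ereal \<Rightarrow> real set" where
  "before b = {t. 0 \<le> t \<and> ereal t < b}"

lemma before_iff: "t \<in> before b \<longleftrightarrow> 0 \<le> t \<and> ereal t < b"
  by (simp add: before_def)

lemma is_interval_before: "is_interval (before b)"
  unfolding is_interval_1 Ball_def before_iff
  by (meson ereal_less_eq(3) order_le_less_trans order_trans)

lemma Icc_subset_before: "T \<in> before b \<Longrightarrow> {0..T} \<subseteq> before b"
  unfolding before_iff subset_iff atLeastAtMost_iff
  by (meson ereal_less_eq(3) order_le_less_trans)

text \<open>Glueing: if t < T < b, then [0,b) and [0,T] coincide near \<open>t\<close>, so
  derivatives may be computed on compact intervals.\<close>

lemma has_vector_derivative_before:
  assumes v: "\<And>T t. T \<in> before b \<Longrightarrow> t \<in> {0..T} \<Longrightarrow> (v T has_vector_derivative D t) (at t within {0..T})"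
    and u: "\<And>T t. T \<in> before b \<Longrightarrow> t \<in> {0..T} \<Longrightarrow> u t = v T t"
    and t: "t \<in> before b"
  shows "(u has_vector_derivative D t) (at t within before b)"
proof -
  obtain T where T: "t < T" "ereal T < b"
    using t ereal_dense2[of "ereal t" b] by (auto simp: before_iff)
  then have T': "T \<in> before b" and tT: "t \<in> {0..T}" using t by (auto simp: before_iff)
  have "before b \<inter> {..<T} - {t} = {0..T} \<inter> {..<T} - {t}"
    using Icc_subset_before[OF T'] by (auto simp: before_iff)
  then have "at t within before b = at t within {0..T}"
    using T(1) by (intro at_within_nhd[of t "{..<T}"]) auto
  moreover have "(u has_vector_derivative D t) (at t within {0..T})"
    using v[OF T' tT] u[OF T'] tT by (auto intro: has_vector_derivative_transform)
  ultimately show ?thesis by simp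
qed

section \<open>Maximal intervals and the flow\<close>

lemma solution_before_sigma_plus:
  assumes "0 \<le> t" and "ereal t < sigma_plus f \<O> x"
  shows "\<exists>\<phi>. solution_on f x {0..t} \<phi> \<and> \<phi> ` {0..t} \<subseteq> \<O>"
proof -
  obtain s where "s \<in> max_interval f \<O> x" "t < s"
    using assms(2) unfolding sigma_plus_def less_Sup_iff by auto
  then obtain J \<phi> where J: "solution_on f x J \<phi>" "\<phi> ` J \<subseteq> \<O>" "s \<in> J"
    unfolding max_interval_def by blast
  then have "0 \<in> J" "is_interval J" by (auto simp: solution_on_def)
  then have "t \<in> J" using J(3) \<open>t < s\<close> assms(1) unfolding is_interval_1 by (meson less_imp_le)
  have "{0..t} \<subseteq> J"
    using \<open>0 \<in> J\<close> \<open>t \<in> J\<close> \<open>is_interval J\<close> unfolding is_interval_1 by (meson atLeastAtMost_iff subsetI)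
  then show ?thesis
    using solution_on_Icc[OF J(1) \<open>t \<in> J\<close> assms(1)] J(2) by blast
qed

lemma flow_before_sigma_plus:
  fixes f :: "'a::euclidean_space \<Rightarrow> 'a"
  assumes "locally_lipschitz f" and "0 \<le> t" and "ereal t < sigma_plus f \<O> x"
  shows "flow f x t \<in> \<O>"
proof -
  obtain \<phi> where \<phi>: "solution_on f x {0..t} \<phi>" "\<phi> ` {0..t} \<subseteq> \<O>"
    using solution_before_sigma_plus[OF assms(2,3)] by blast
  then show ?thesis using flow_eq[OF assms(1) \<phi>(1), of t] assms(2) by auto
qed

text \<open>The supremum is approached from below: \<open>b\<close> itself is not a time of the
  solution, but every nonnegative c < b is.\<close>

lemma le_sigma_plus:
  assumes "solution_on f x (before b) \<phi>"
  shows "b \<le> sigma_plus f UNIV x"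
proof (rule dense_le)
  fix c assume "c < b"
  have sub: "ereal ` before b \<subseteq> ereal ` max_interval f UNIV x"
    using assms unfolding max_interval_def by blast
  have "0 \<in> before b" using assms by (simp add: solution_on_def)
  show "c \<le> sigma_plus f UNIV x"
  proof (cases "c \<le> 0")
    case True
    have "0 \<le> sigma_plus f UNIV x"
      unfolding sigma_plus_def using sub \<open>0 \<in> before b\<close> by (intro Sup_upper) (auto simp: zero_ereal_def)
    then show ?thesis using True by (rule order_trans[rotated])
  next
    case False
    then obtain r where "c = ereal r" "0 \<le> r" using \<open>c < b\<close> by (cases c) auto
    then have "c \<in> ereal ` before b" using \<open>c < b\<close> by (simp add: before_iff)
    then show ?thesis
      unfolding sigma_plus_def using sub by (intro Sup_upper) blast
  qed
qed

lemma sigma_plus_pos: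
  fixes f :: "'a::euclidean_space \<Rightarrow> 'a"
  assumes "locally_lipschitz f"
  shows "0 < sigma_plus f UNIV x"
proof -
  obtain T \<phi> where T: "0 < T" "solution_on f x {0..T} \<phi>"
    using local_solution_exists[OF assms] by blast
  have "T \<in> {0..T}" using T(1) by simp
  then have "ereal T \<in> ereal ` max_interval f UNIV x"
    using T(2) unfolding max_interval_def by blast
  then have "ereal T \<le> sigma_plus f UNIV x"
    unfolding sigma_plus_def by (rule Sup_upper)
  then show ?thesis using T(1) by (metis ereal_less(2) order_less_le_trans)
qed

lemma solution_on_flow:
  fixes f :: "'a::euclidean_space \<Rightarrow> 'a"
  assumes f: "locally_lipschitz f"
  shows "solution_on f x (before (sigma_plus f UNIV x)) (flow f x)"
proof -
  define b where "b = sigma_plus f UNIV x"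
  have "\<forall>T\<in>before b. \<exists>\<phi>. solution_on f x {0..T} \<phi>"
    using solution_before_sigma_plus[of _ f UNIV x] by (auto simp: b_def before_iff)
  then obtain v where v: "\<And>T. T \<in> before b \<Longrightarrow> solution_on f x {0..T} (v T)"
    by metis
  have eq: "flow f x t = v T t" if "T \<in> before b" "t \<in> {0..T}" for t T
    using flow_eq[OF f v] that by blast
  have "0 \<in> before b" using sigma_plus_pos[OF f] by (simp add: b_def before_iff zero_ereal_def)
  then have "flow f x 0 = x" using eq[of 0 0] v[of 0] by (simp add: solution_on_def)
  moreover have "(flow f x has_vector_derivative f (flow f x t)) (at t within before b)"
    if "t \<in> before b" for t
    using v eq that
    by (intro has_vector_derivative_before[where v = v and D = "\<lambda>t. f (flow f x t)"])
      (auto simp: solution_on_def)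
  ultimately show ?thesis
    using \<open>0 \<in> before b\<close> is_interval_before by (simp add: solution_on_def b_def)
qed

lemma lipschitz_ode_unique:
  fixes G :: "'a::real_inner \<Rightarrow> 'a"
  assumes "L-lipschitz_on UNIV G"
    and "\<And>t. t \<in> {0..T} \<Longrightarrow> (u has_vector_derivative G (u t) + \<beta> t) (at t within {0..T})"
    and "\<And>t. t \<in> {0..T} \<Longrightarrow> (v has_vector_derivative G (v t) + \<beta> t) (at t within {0..T})"
    and "u 0 = v 0" and "t \<in> {0..T}"
  shows "u t = v t"
proof (rule ode_unique[where F = "\<lambda>t y. G y + \<beta> t" and a = 0 and b = T and L = L])
  show "norm (G (u s) + \<beta> s - (G (v s) + \<beta> s)) \<le> L * norm (u s - v s)" for s
    using lipschitz_onD[OF assms(1), of "u s" "v s"] by (simp add: dist_norm)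
qed (use assms in auto)

lemma lipschitz_ode_exists_before:
  fixes G :: "'a::euclidean_space \<Rightarrow> 'a"
  assumes G: "L-lipschitz_on UNIV G" and \<beta>: "continuous_on (before b) \<beta>"
  obtains u where "u 0 = u0"
    and "\<And>t. t \<in> before b \<Longrightarrow> (u has_vector_derivative G (u t) + \<beta> t) (at t within before b)"
proof -
  have "\<exists>v. v 0 = u0 \<and> (\<forall>t\<in>{0..T}. (v has_vector_derivative G (v t) + \<beta> t) (at t within {0..T}))"
    if "T \<in> before b" for T
  proof -
    have "0 \<le> T" using that by (simp add: before_iff)
    then show ?thesis
      using lipschitz_ode_exists[OF G continuous_on_subset[OF \<beta> Icc_subset_before[OF that]], of u0] by metis
  qed
  then obtain v where v0: "\<And>T. T \<in> before b \<Longrightarrow> v T 0 = u0"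
    and v: "\<And>T t. T \<in> before b \<Longrightarrow> t \<in> {0..T} \<Longrightarrow>
      (v T has_vector_derivative G (v T t) + \<beta> t) (at t within {0..T})"
    by metis
  \<comment> \<open>Diagonal choice. The value at 0 is set separately so that
    \<open>u 0 = u0\<close> holds even when \<open>before b\<close> is empty and nothing is known
    about \<open>v\<close>.\<close>
  define u where "u t = (if t = 0 then u0 else v t t)" for t
  have eq: "u t = v T t" if T: "T \<in> before b" and t: "t \<in> {0..T}" for t T
  proof (cases "t = 0")
    case False
    have t': "t \<in> before b" using Icc_subset_before[OF T] t by blast
    have "v t t = v T t"
    proof (rule lipschitz_ode_unique[OF G, where T = t and u = "v t" and v = "v T"])
      show "(v T has_vector_derivative G (v T s) + \<beta> s) (at s within {0..t})" if "s \<in> {0..t}" for s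
        by (rule has_vector_derivative_within_subset[OF v[OF T]]) (use t that in auto)
    qed (use v v0 t t' T in auto)
    then show ?thesis using False by (simp add: u_def)
  qed (use v0 T in \<open>simp add: u_def\<close>)
  show thesis
  proof
    show "u 0 = u0" by (simp add: u_def)
    show "(u has_vector_derivative G (u t) + \<beta> t) (at t within before b)" if "t \<in> before b" for t
    proof (rule has_vector_derivative_before[where v = v and D = "\<lambda>t. G (u t) + \<beta> t"])
      show "(v T has_vector_derivative G (u t) + \<beta> t) (at t within {0..T})"
        if "T \<in> before b" "t \<in> {0..T}" for T t
        using v[OF that] eq[OF that] by simp
    qed (use eq that in auto)
  qed
qed

section \<open>Cascades: an autonomous equation driving a globally Lipschitz one\<close>

lemma solution_on_cascade_iff:
  "solution_on (\<lambda>(x, z). (f x, G z + k x)) (x, z) J \<phi> \<longleftrightarrow>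
     solution_on f x J (\<lambda>t. fst (\<phi> t)) \<and> snd (\<phi> 0) = z \<and>
     (\<forall>t\<in>J. ((\<lambda>t. snd (\<phi> t)) has_vector_derivative G (snd (\<phi> t)) + k (fst (\<phi> t))) (at t within J))"
  (is "?lhs \<longleftrightarrow> ?rhs")
proof
  assume ?lhs
  then have \<phi>: "is_interval J" "0 \<in> J" "\<phi> 0 = (x, z)"
    "\<And>t. t \<in> J \<Longrightarrow> (\<phi> has_vector_derivative (f (fst (\<phi> t)), G (snd (\<phi> t)) + k (fst (\<phi> t)))) (at t within J)"
    by (auto simp: solution_on_def split_beta)
  have "((\<lambda>t. fst (\<phi> t)) has_vector_derivative f (fst (\<phi> t))) (at t within J)" if "t \<in> J" for t
    using bounded_linear.has_vector_derivative[OF bounded_linear_fst \<phi>(4)[OF that]] by simp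
  moreover have "((\<lambda>t. snd (\<phi> t)) has_vector_derivative G (snd (\<phi> t)) + k (fst (\<phi> t))) (at t within J)"
    if "t \<in> J" for t
    using bounded_linear.has_vector_derivative[OF bounded_linear_snd \<phi>(4)[OF that]] by simp
  ultimately show ?rhs using \<phi>(1-3) by (simp add: solution_on_def)
next
  assume ?rhs
  then have \<phi>: "is_interval J" "0 \<in> J" "\<phi> 0 = (x, z)"
    and d: "\<And>t. t \<in> J \<Longrightarrow> ((\<lambda>t. fst (\<phi> t)) has_vector_derivative f (fst (\<phi> t))) (at t within J)"
    "\<And>t. t \<in> J \<Longrightarrow>
      ((\<lambda>t. snd (\<phi> t)) has_vector_derivative G (snd (\<phi> t)) + k (fst (\<phi> t))) (at t within J)"
    by (auto simp: solution_on_def prod_eq_iff)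
  have "(\<phi> has_vector_derivative (f (fst (\<phi> t)), G (snd (\<phi> t)) + k (fst (\<phi> t)))) (at t within J)"
    if "t \<in> J" for t
    using has_vector_derivative_Pair[OF d[OF that]] by simp
  then show ?lhs using \<phi> by (simp add: solution_on_def split_beta)
qed

lemma cascade_maximal_solution_exists:
  fixes f :: "'a::euclidean_space \<Rightarrow> 'a" and G :: "'b::euclidean_space \<Rightarrow> 'b"
  assumes f: "locally_lipschitz f" and G: "L-lipschitz_on UNIV G" and k: "continuous_on UNIV k"
  shows "\<exists>\<phi>. right_maximal_solution (\<lambda>(x, z). (f x, G z + k x)) (x, z) (sigma_plus f UNIV x) \<phi>"
proof -
  define b where "b = sigma_plus f UNIV x"
  have sol: "solution_on f x (before b) (flow f x)"
    unfolding b_def by (rule solution_on_flow[OF f])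
  have "continuous_on (before b) (\<lambda>t. k (flow f x t))"
    by (intro continuous_on_compose2[OF k] solution_on_continuous[OF sol]) auto
  then obtain u where "u 0 = z" "\<And>t. t \<in> before b \<Longrightarrow>
      (u has_vector_derivative G (u t) + k (flow f x t)) (at t within before b)"
    using lipschitz_ode_exists_before[OF G] by metis
  then have "solution_on (\<lambda>(x, z). (f x, G z + k x)) (x, z) (before b) (\<lambda>t. (flow f x t, u t))"
    unfolding solution_on_cascade_iff using sol by simp
  \<comment> \<open>A longer solution of the cascade would project to a solution of the first
    equation that outlives \<open>sigma_plus\<close>.\<close>
  moreover have "b' \<le> b" if "solution_on (\<lambda>(x, z). (f x, G z + k x)) (x, z) (before b') \<psi>" for b' \<psi>
    using that unfolding solution_on_cascade_iff b_def by (blast intro: le_sigma_plus)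
  ultimately have "right_maximal_solution (\<lambda>(x, z). (f x, G z + k x)) (x, z) b (\<lambda>t. (flow f x t, u t))"
    unfolding right_maximal_solution_def before_def[symmetric] b_def
    using sigma_plus_pos[OF f] by (auto simp: not_le[symmetric])
  then show ?thesis unfolding b_def by blast
qed

lemma cascade_unique:
  fixes f :: "'a::euclidean_space \<Rightarrow> 'a" and G :: "'b::euclidean_space \<Rightarrow> 'b"
  assumes f: "locally_lipschitz f" and G: "L-lipschitz_on UNIV G"
    and \<phi>: "solution_on (\<lambda>(x, z). (f x, G z + k x)) (x, z) J \<phi>"
    and \<psi>: "solution_on (\<lambda>(x, z). (f x, G z + k x)) (x, z) J' \<psi>"
    and t: "t \<in> J" "t \<in> J'" "0 \<le> t"
  shows "\<phi> t = \<psi> t"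
proof -
  note sol = solution_on_Icc[OF \<phi> t(1,3), unfolded solution_on_cascade_iff]
    solution_on_Icc[OF \<psi> t(2,3), unfolded solution_on_cascade_iff]
  have fst: "fst (\<phi> s) = fst (\<psi> s)" if "s \<in> {0..t}" for s
    using solution_unique[OF f, of x "{0..t}" "\<lambda>t. fst (\<phi> t)" "{0..t}" "\<lambda>t. fst (\<psi> t)" s] sol that by blast
  \<comment> \<open>Once the first components agree, both second components solve one equation with
    the same forcing term.\<close>
  have "snd (\<phi> t) = snd (\<psi> t)"
    by (rule lipschitz_ode_unique[OF G, where T = t and \<beta> = "\<lambda>s. k (fst (\<phi> s))"])
      (use sol fst t in auto)
  then show ?thesis using fst[of t] t(3) by (simp add: prod_eq_iff)
qed

lemma cascade_maximal_solution_end: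
  fixes f :: "'a::euclidean_space \<Rightarrow> 'a" and G :: "'b::euclidean_space \<Rightarrow> 'b"
  assumes f: "locally_lipschitz f" and G: "L-lipschitz_on UNIV G" and k: "continuous_on UNIV k"
    and \<phi>: "right_maximal_solution (\<lambda>(x, z). (f x, G z + k x)) (x, z) b \<phi>"
  shows "b = sigma_plus f UNIV x"
proof -
  obtain \<psi> where \<psi>: "right_maximal_solution (\<lambda>(x, z). (f x, G z + k x)) (x, z) (sigma_plus f UNIV x) \<psi>"
    using cascade_maximal_solution_exists[OF f G k] by blast
  note sol = \<phi>[unfolded right_maximal_solution_def before_def[symmetric]]
    \<psi>[unfolded right_maximal_solution_def before_def[symmetric]]
  have "solution_on f x (before b) (\<lambda>t. fst (\<phi> t))"
    using sol(1) unfolding solution_on_cascade_iff by blast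
  then have "b \<le> sigma_plus f UNIV x" by (rule le_sigma_plus)
  \<comment> \<open>The solution \<open>\<psi>\<close> living up to \<open>sigma_plus\<close> agrees
    with \<open>\<phi>\<close> before \<open>b\<close>, so it would be a proper extension.\<close>
  moreover have "\<not> b < sigma_plus f UNIV x"
  proof
    assume less: "b < sigma_plus f UNIV x"
    have "\<psi> t = \<phi> t" if "0 \<le> t" "ereal t < b" for t
      using cascade_unique[OF f G conjunct1[OF conjunct2[OF sol(2)]] conjunct1[OF conjunct2[OF sol(1)]]]
        that less by (simp add: before_iff)
    then show False using sol less by blast
  qed
  ultimately show ?thesis by simp
qed

section \<open>The Lyapunov matrix equation\<close>

lemma psd_Cauchy_Schwarz:
  fixes L :: "'a::real_inner \<Rightarrow> 'a"
  assumes lin: "linear L" and adj: "\<And>v w. L v \<bullet> w = v \<bullet> L w" and psd: "\<And>v. 0 \<le> v \<bullet> L v"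
  shows "(v \<bullet> L w)\<^sup>2 \<le> (v \<bullet> L v) * (w \<bullet> L w)"
proof -
  interpret linear L by (rule lin)
  define a b c where "a = v \<bullet> L v" and "b = v \<bullet> L w" and "c = w \<bullet> L w"
  have "w \<bullet> L v = b" unfolding b_def by (metis adj inner_commute)
  then have quad: "0 \<le> a + 2 * t * b + t\<^sup>2 * c" for t
    using psd[of "v + t *\<^sub>R w"]
    by (simp add: a_def b_def c_def add scale inner_add_left inner_add_right power2_eq_square algebra_simps)
  have "b\<^sup>2 \<le> a * c"
  proof (cases "c = 0")
    case True
    have "b = 0"
    proof (rule ccontr)
      assume "b \<noteq> 0"
      \<comment> \<open>At this argument the left-over affine function takes the value -1.\<close>
      then show False using quad[of "- (a + 1) / (2 * b)"] True by (simp add: field_simps)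
    qed
    then show ?thesis using True by simp
  next
    case False
    then have "0 < c" using psd[of w] by (simp add: c_def)
    then show ?thesis
      using quad[of "- b / c"] by (simp add: field_simps power2_eq_square)
  qed
  then show ?thesis by (simp add: a_def b_def c_def)
qed

text \<open>A maximiser \<open>v\<close> on the unit sphere is an eigenvector because \<mu> I - L is
  positive semidefinite and its form vanishes at \<open>v\<close>: Cauchy-Schwarz for that form
  forces \<open>M v = 0\<close>.\<close>

lemma Rayleigh_max:
  fixes L :: "'a::euclidean_space \<Rightarrow> 'a"
  assumes lin: "linear L" and adj: "\<And>v w. L v \<bullet> w = v \<bullet> L w"
  obtains v \<mu> where "v \<noteq> 0" and "L v = \<mu> *\<^sub>R v" and "\<And>w. w \<bullet> L w \<le> \<mu> * (w \<bullet> w)"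
proof -
  interpret linear L by (rule lin)
  have "continuous_on (sphere 0 1) (\<lambda>w. w \<bullet> L w)"
    by (intro continuous_intros linear_continuous_on linear_conv_bounded_linear[THEN iffD1] lin)
  moreover have "sphere (0 :: 'a) 1 \<noteq> {}" by simp
  ultimately have "\<exists>v\<in>sphere 0 1. \<forall>w\<in>sphere 0 1. w \<bullet> L w \<le> v \<bullet> L v"
    by (intro continuous_attains_sup compact_sphere)
  then obtain v where v: "norm v = 1" and max: "\<And>w. norm w = 1 \<Longrightarrow> w \<bullet> L w \<le> v \<bullet> L v"
    by auto
  define \<mu> where "\<mu> = v \<bullet> L v"
  have bound: "w \<bullet> L w \<le> \<mu> * (w \<bullet> w)" for w
  proof (cases "w = 0")
    case False
    define u where "u = w /\<^sub>R norm w"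
    have w: "w = norm w *\<^sub>R u" using False by (simp add: u_def)
    have "norm u = 1" using False by (simp add: u_def)
    then have "u \<bullet> L u \<le> \<mu>" using max by (simp add: \<mu>_def)
    then have "(norm w)\<^sup>2 * (u \<bullet> L u) \<le> (norm w)\<^sup>2 * \<mu>" by (intro mult_left_mono) auto
    moreover have "w \<bullet> L w = (norm w)\<^sup>2 * (u \<bullet> L u)"
      by (subst (1 2) w) (simp add: scale power2_eq_square)
    ultimately show ?thesis by (simp add: dot_square_norm mult.commute)
  qed (simp add: zero)
  define M where "M w = \<mu> *\<^sub>R w - L w" for w
  have "linear M"
    unfolding M_def by (intro linear_compose_sub lin linear_compose_scale_right linear_ident)
  moreover have "M w \<bullet> u = w \<bullet> M u" for w u
    by (simp add: M_def inner_diff_left inner_diff_right adj)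
  moreover have "0 \<le> w \<bullet> M w" for w
    using bound[of w] by (simp add: M_def inner_diff_right)
  ultimately have "(M v \<bullet> M v)\<^sup>2 \<le> (M v \<bullet> M (M v)) * (v \<bullet> M v)"
    by (rule psd_Cauchy_Schwarz)
  also have "v \<bullet> M v = 0" using v by (simp add: M_def inner_diff_right \<mu>_def dot_square_norm)
  finally have "M v = 0" by simp
  then show thesis using v bound by (intro that[of v \<mu>]) (auto simp: M_def)
qed

text \<open>\<open>L\<close> may be indefinite on the whole space. The complement \<open>T\<close>
  with respect to its form has codimension at most \<open>dim S\<close>, and it meets
  \<open>S\<close> only in 0 because \<open>S\<close> has no nonzero isotropic vector.\<close>

lemma form_orthogonal_decomposition:
  fixes L :: "'a::euclidean_space \<Rightarrow> 'a"
  assumes lin: "linear L" and adj: "\<And>v w. L v \<bullet> w = v \<bullet> L w" and S: "subspace S"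
    and nondeg: "\<And>v. v \<in> S \<Longrightarrow> v \<bullet> L v = 0 \<Longrightarrow> v = 0"
  obtains u w where "v = u + w" and "u \<in> S" and "\<And>s. s \<in> S \<Longrightarrow> s \<bullet> L w = 0"
proof -
  define T where "T = {w. \<forall>s\<in>S. s \<bullet> L w = 0}"
  have T: "T = {w \<in> UNIV. \<forall>s\<in>L ` S. orthogonal s w}"
    by (auto simp: T_def orthogonal_def adj)
  have subT: "subspace T"
    unfolding T_def
    by (rule subspaceI) (auto simp: linear_0[OF lin] linear_add[OF lin] linear_scale[OF lin] inner_add_right)
  have "dim T + dim (L ` S) = DIM('a)"
    using dim_subspace_orthogonal_to_vectors[of "L ` S" "UNIV :: 'a set"] linear_subspace_image[OF lin S]
    unfolding T by simp
  moreover have "dim (L ` S) \<le> dim S" by (rule dim_image_le[OF lin])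
  moreover have "S \<inter> T = {0}"
    using nondeg subspace_0[OF S] subspace_0[OF subT] by (auto simp: T_def)
  ultimately have "DIM('a) \<le> dim {x + y |x y. x \<in> S \<and> y \<in> T}"
    using dim_sums_Int[OF S subT] by simp
  then have "span {x + y |x y. x \<in> S \<and> y \<in> T} = UNIV"
    using dim_eq_full dim_subset_UNIV le_antisym by blast
  then have "{x + y |x y. x \<in> S \<and> y \<in> T} = UNIV"
    by (simp only: span_eq_iff[THEN iffD2, OF subspace_sums[OF S subT]])
  then obtain u w where "v = u + w" "u \<in> S" "w \<in> T" by blast
  then show thesis using that by (auto simp: T_def)
qed

lemma inner_mult_cnj: "(a * b) \<bullet> c = b \<bullet> (cnj a * c)" for a b c :: complex
  by (simp add: inner_complex_def algebra_simps)

text \<open>The inner product here is the real part of the Hermitian one, so the real adjoint of a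
  complex matrix is its conjugate transpose, and the real spectral lemmas above apply to
  \<open>P\<close>.\<close>

lemma inner_matrix_vector_mult: "(M *v v) \<bullet> w = v \<bullet> (conj_transpose M *v w)"
  for M :: "complex^'n^'m"
proof -
  have "(M *v v) \<bullet> w = (\<Sum>i\<in>UNIV. \<Sum>j\<in>UNIV. v $ j \<bullet> (cnj (M $ i $ j) * w $ i))"
    by (simp add: inner_vec_def matrix_vector_mult_def inner_sum_left inner_mult_cnj)
  also have "\<dots> = v \<bullet> (conj_transpose M *v w)"
    by (subst sum.swap)
      (simp add: inner_vec_def matrix_vector_mult_def inner_sum_right conj_transpose_def)
  finally show ?thesis .
qed

text \<open>Reduces the Frobenius inner product to vectors, since left multiplication acts column by
  column.\<close>

lemma inner_columns: "Z \<bullet> W = (\<Sum>j\<in>UNIV. column j Z \<bullet> column j W)"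
  for Z W :: "complex^'p^'m"
  unfolding inner_vec_def column_def by (subst sum.swap) simp

lemma column_matrix_mult: "column j (M ** Z) = M *v column j Z"
  for M :: "complex^'n^'m" and Z :: "complex^'p^'n"
  by (simp add: column_def matrix_matrix_mult_def matrix_vector_mult_def vec_eq_iff)

lemma column_eq_0_imp_eq_0: "(\<And>j. column j Z = 0) \<Longrightarrow> Z = 0" for Z :: "complex^'p^'m"
  by (simp add: column_def vec_eq_iff)

lemma linear_matrix_vector_mult: "linear ((*v) M)" for M :: "complex^'n^'m"
  by (rule linearI)
    (simp_all add: matrix_vector_right_distrib matrix_vector_mult_def vec_eq_iff scaleR_sum_right sum.distrib distrib_left)

lemma linear_matrix_mult: "linear ((**) M :: complex^'p^'n \<Rightarrow> complex^'p^'m)"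
  by (rule linearI)
    (simp_all add: matrix_add_ldistrib matrix_matrix_mult_def vec_eq_iff scaleR_sum_right sum.distrib distrib_left)

text \<open>The kernel of the product of the factors A - l I over the list. The factors commute, so
  each kernel is invariant under \<open>A\<close>; the growing chain of kernels plays the role of a
  triangular form of \<open>A\<close>.\<close>

primrec killed :: "complex^'m^'m \<Rightarrow> complex list \<Rightarrow> (complex^'m) set" where
  "killed A [] = {0}"
| "killed A (l # ls) = {v. A *v v - l *s v \<in> killed A ls}"

lemma scaleR_eq_vector_scalar: "r *\<^sub>R v = complex_of_real r *s v" for v :: "complex^'m"
  unfolding vec_eq_iff by (simp add: scaleR_conv_of_real[where 'a = complex])

lemma killed_scale: "v \<in> killed A ls \<Longrightarrow> c *s v \<in> killed A ls"
proof (induction ls arbitrary: v)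
  case (Cons l ls)
  have eq: "A *v (c *s v) - l *s (c *s v) = c *s (A *v v - l *s v)"
    by (simp add: vector_scalar_commute vec.scale_right_diff_distrib mult.commute)
  show ?case
    unfolding killed.simps mem_Collect_eq eq by (rule Cons.IH) (use Cons.prems in simp)
qed simp

lemma killed_add: "v \<in> killed A ls \<Longrightarrow> w \<in> killed A ls \<Longrightarrow> v + w \<in> killed A ls"
proof (induction ls arbitrary: v w)
  case (Cons l ls)
  have eq: "A *v (v + w) - l *s (v + w) = (A *v v - l *s v) + (A *v w - l *s w)"
    by (simp add: matrix_vector_right_distrib vec.scale_right_distrib)
  show ?case
    unfolding killed.simps mem_Collect_eq eq by (rule Cons.IH) (use Cons.prems in simp_all)
qed simp

lemma subspace_killed: "subspace (killed A ls)"
proof (rule subspaceI)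
  show "0 \<in> killed A ls" by (induction ls) simp_all
qed (simp_all add: killed_add killed_scale scaleR_eq_vector_scalar)

lemma killed_invariant: "v \<in> killed A ls \<Longrightarrow> A *v v - l *s v \<in> killed A ls"
proof (induction ls arbitrary: v)
  case (Cons k ls)
  have eq: "A *v (A *v v - l *s v) - k *s (A *v v - l *s v) = A *v (A *v v - k *s v) - l *s (A *v v - k *s v)"
    by (simp add: matrix_vector_mult_diff_distrib vector_scalar_commute vec.scale_right_diff_distrib
        mult.commute)
  show ?case
    unfolding killed.simps mem_Collect_eq eq by (rule Cons.IH) (use Cons.prems in simp)
qed simp

text \<open>The vector p(A) v, evaluated by Horner's scheme so that no matrix powers occur.\<close>

definition peval :: "complex^'m^'m \<Rightarrow> complex poly \<Rightarrow> complex^'m \<Rightarrow> complex^'m" where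
  "peval A p v = fold_coeffs (\<lambda>a w. a *s v + A *v w) p 0"

lemma peval_0 [simp]: "peval A 0 v = 0"
  by (simp add: peval_def)

lemma peval_pCons [simp]: "peval A (pCons a p) v = a *s v + A *v peval A p v"
  by (cases "p = 0 \<and> a = 0") (auto simp: peval_def)

lemma peval_add: "peval A (p + q) v = peval A p v + peval A q v"
  by (induction p q rule: poly_induct2)
    (simp_all add: vec.scale_left_distrib matrix_vector_right_distrib)

lemma peval_smult: "peval A (smult c p) v = c *s peval A p v"
  by (induction p) (simp_all add: vec.scale_right_distrib vector_scalar_commute)

lemma peval_linear_mult: "peval A ([:- l, 1:] * q) v = A *v peval A q v - l *s peval A q v"
proof -
  have "[:- l, 1:] * q = pCons 0 q + smult (- l) q" by simp
  then show ?thesis by (simp only: peval_add peval_smult peval_pCons) simp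
qed

text \<open>Moves A - l I past q(A). With the factor outside, a nonzero q(A) v is an eigenvector
  when the product vanishes; with the factor inside, q annihilates the vector (A - l I) v.\<close>

lemma peval_linear_mult': "peval A ([:- l, 1:] * q) v = peval A q (A *v v - l *s v)"
  unfolding peval_linear_mult
proof (induction q)
  case (pCons a q)
  then show ?case
    by (simp add: matrix_vector_mult_diff_distrib matrix_vector_right_distrib vector_scalar_commute
        vec.scale_right_diff_distrib vec.scale_right_distrib add_diff_add mult.commute flip: pCons.IH)
qed simp

text \<open>The space has finite real dimension, so some A^k v lies in the real span of the A^i v
  with i < k.\<close>

lemma annihilating_polynomial_exists:
  fixes v :: "complex^'m"
  shows "\<exists>p. p \<noteq> 0 \<and> peval A p v = 0"
proof -
  define x where "x i = peval A (monom 1 i) v" for i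
  have "\<exists>k. x k \<in> span (x ` {..<k})"
  proof (rule ccontr)
    assume *: "\<not> ?thesis"
    have indep: "independent (x ` {..<k}) \<and> card (x ` {..<k}) = k" for k
    proof (induction k)
      case (Suc k)
      have "x k \<notin> span (x ` {..<k})" using * by simp
      moreover from this have "x k \<notin> x ` {..<k}" using span_base by metis
      ultimately show ?case
        using Suc unfolding lessThan_Suc image_insert by (simp add: independent_insert)
    qed (simp add: independent_empty)
    have "k \<le> DIM(complex^'m)" for k
      using independent_bound[OF conjunct1[OF indep[of k]]] conjunct2[OF indep[of k]] by linarith
    then show False using Suc_n_not_le_n by blast
  qed
  then obtain k where k: "x k \<in> span (x ` {..<k})" by blast
  \<comment> \<open>The polynomials of degree below \<open>k\<close>: subtracting one of them from
    the monomial of degree \<open>k\<close> leaves the coefficient 1 at \<open>k\<close>, so the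
    annihilator is nonzero.\<close>
  define Q where "Q = {q :: complex poly. \<forall>i\<ge>k. coeff q i = 0}"
  have "subspace ((\<lambda>q. peval A q v) ` Q)"
  proof (rule subspaceI)
    show "0 \<in> (\<lambda>q. peval A q v) ` Q"
      by (rule image_eqI[of _ _ 0]) (auto simp: Q_def)
    fix a b and c :: real
    assume "a \<in> (\<lambda>q. peval A q v) ` Q"
    then obtain p where p: "p \<in> Q" "a = peval A p v" by blast
    show "c *\<^sub>R a \<in> (\<lambda>q. peval A q v) ` Q"
      unfolding p(2) scaleR_eq_vector_scalar peval_smult[symmetric]
      by (rule imageI) (use p(1) in \<open>auto simp: Q_def\<close>)
    assume "b \<in> (\<lambda>q. peval A q v) ` Q"
    then obtain q where q: "q \<in> Q" "b = peval A q v" by blast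
    show "a + b \<in> (\<lambda>q. peval A q v) ` Q"
      unfolding p(2) q(2) peval_add[symmetric]
      by (rule imageI) (use p(1) q(1) in \<open>auto simp: Q_def\<close>)
  qed
  moreover have "x ` {..<k} \<subseteq> (\<lambda>q. peval A q v) ` Q"
  proof (clarsimp simp: x_def)
    fix i assume "i < k"
    then show "peval A (monom 1 i) v \<in> (\<lambda>q. peval A q v) ` Q"
      by (intro imageI) (auto simp: Q_def)
  qed
  ultimately have "x k \<in> (\<lambda>q. peval A q v) ` Q"
    using k span_minimal by blast
  then obtain q where q: "coeff q k = 0" "x k = peval A q v" by (auto simp: Q_def)
  have "coeff (monom 1 k + smult (- 1) q) k = 1" using q by simp
  then have "monom 1 k + smult (- 1) q \<noteq> 0" by force
  moreover have "peval A (monom 1 k + smult (- 1) q) v = 0"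
    using q(2) by (simp only: peval_add peval_smult) (simp add: x_def)
  ultimately show ?thesis by blast
qed

text \<open>Split off a root l. If l is an eigenvalue, it joins the list and the induction continues
  with (A - l I) v; otherwise A - l I is injective and its factor can be cancelled.\<close>

lemma killed_by_eigenvalues:
  assumes "p \<noteq> 0" and "peval A p v = 0"
  shows "\<exists>ls. (\<forall>l\<in>set ls. eigenvalue A l) \<and> v \<in> killed A ls"
  using assms
proof (induction "degree p" arbitrary: p v rule: less_induct)
  case less
  show ?case
  proof (cases "degree p = 0")
    case True
    then obtain a where "p = [:a:]" by (rule degree_eq_zeroE)
    then have "v = 0" using less.prems by auto
    then show ?thesis by (intro exI[of _ "[]"]) simp
  next
    case False
    then obtain l where "poly p l = 0"
      using fundamental_theorem_of_algebra[of p] by (auto simp: constant_degree)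
    then obtain q where p: "p = [:- l, 1:] * q"
      unfolding poly_eq_0_iff_dvd by (elim dvdE)
    have q: "q \<noteq> 0" "degree q < degree p"
      using less.prems(1) unfolding p by (auto simp del: mult_pCons_left simp: degree_mult_eq)
    show ?thesis
    proof (cases "eigenvalue A l")
      case True
      obtain ls where "\<forall>l\<in>set ls. eigenvalue A l" "A *v v - l *s v \<in> killed A ls"
        using less.hyps[OF q(2,1), of "A *v v - l *s v"] less.prems(2)
        unfolding p peval_linear_mult' by blast
      then show ?thesis using True by (intro exI[of _ "l # ls"]) simp
    next
      case False
      then have "peval A q v = 0"
        using less.prems(2) unfolding p peval_linear_mult eigenvalue_def by auto
      then show ?thesis using less.hyps q by blast
    qed
  qed
qed

section \<open>Positivity and the largest eigenvalue of the Lyapunov matrix\<close>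

lemma Lyapunov_inner:
  fixes A P :: "complex^'m^'m"
  assumes "hermitian P" and "conj_transpose A ** P + P ** A = - mat 1"
  shows "2 * ((A *v v) \<bullet> (P *v v)) = - (v \<bullet> v)"
proof -
  have "(A *v v) \<bullet> (P *v v) + (P *v v) \<bullet> (A *v v) = v \<bullet> ((conj_transpose A ** P + P ** A) *v v)"
    using assms(1)
    by (simp add: inner_matrix_vector_mult hermitian_def matrix_vector_mult_add_rdistrib inner_add_right
        flip: matrix_vector_mul_assoc)
  then show ?thesis
    unfolding assms(2) using matrix_vector_mult_diff_rdistrib[of 0 "mat 1" v] by (simp add: inner_commute)
qed

text \<open>If \<open>w\<close> is \<open>P\<close>-orthogonal to \<open>killed A ls\<close> and \<open>A w - l w\<close> lies in that set, the Lyapunov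
  equation reads \<open>2 Re l (w, P w) = - \<bar>w\<bar>\<^sup>2\<close>.\<close>

lemma Lyapunov_pos_on_killed:
  fixes A P :: "complex^'m^'m"
  assumes P: "hermitian P" and Lyap: "conj_transpose A ** P + P ** A = - mat 1"
    and "\<forall>l\<in>set ls. Re l < 0" and "v \<in> killed A ls" and "v \<noteq> 0"
  shows "0 < v \<bullet> (P *v v)"
  using assms(3-)
proof (induction ls arbitrary: v)
  case (Cons l ls)
  have adj: "(P *v a) \<bullet> b = a \<bullet> (P *v b)" for a b
    using P by (simp add: inner_matrix_vector_mult hermitian_def)
  \<comment> \<open>By the induction hypothesis the form of \<open>P\<close> has no nonzero
    isotropic vector in \<open>killed A ls\<close>, so \<open>v\<close> splits into a part in this
    set and a part \<open>P\<close>-orthogonal to it.\<close>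
  have "a = 0" if "a \<in> killed A ls" "a \<bullet> (P *v a) = 0" for a
    using Cons.IH[OF _ that(1)] Cons.prems(1) that(2) by auto
  then obtain u w where v: "v = u + w" and u: "u \<in> killed A ls"
    and w: "\<And>s. s \<in> killed A ls \<Longrightarrow> s \<bullet> (P *v w) = 0"
    using form_orthogonal_decomposition[OF linear_matrix_vector_mult adj subspace_killed] by blast
  have w_pos: "0 < w \<bullet> (P *v w)" if "w \<noteq> 0"
  proof -
    have "w = v + (- 1) *s u" by (simp add: v)
    moreover have "u \<in> killed A (l # ls)" using killed_invariant[OF u] by simp
    ultimately have "w \<in> killed A (l # ls)"
      by (simp only: killed_add killed_scale Cons.prems(2))
    then have "(A *v w - l *s w) \<bullet> (P *v w) = 0" by (simp add: w)
    moreover have "(l *s w) \<bullet> (P *v w) = Re l * (w \<bullet> (P *v w))"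
    proof -
      \<comment> \<open>Multiplication by i is skew-adjoint and commutes with \<open>P\<close>, so
        (i w, P w) equals its own negative; only the real part of \<open>l\<close> survives.\<close>
      have i: "(\<i> *s a) \<bullet> b = - (a \<bullet> (\<i> *s b))" for a b :: "complex^'m"
        unfolding inner_vec_def sum_negf[symmetric]
        by (intro sum.cong refl) (simp add: inner_complex_def)
      have "(\<i> *s w) \<bullet> (P *v w) = 0"
        using i[of w "P *v w"] adj[of "\<i> *s w" w]
        by (simp add: vector_scalar_commute inner_commute)
      moreover have "l *s w = Re l *\<^sub>R w + Im l *\<^sub>R (\<i> *s w)"
        by (simp add: vec_eq_iff complex_eq_iff)
      ultimately show ?thesis by (simp add: inner_add_left)
    qed
    ultimately have "2 * Re l * (w \<bullet> (P *v w)) = - (w \<bullet> w)"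
      using Lyapunov_inner[OF P Lyap, of w] by (simp add: inner_diff_left)
    moreover have "0 < w \<bullet> w" "Re l < 0" using that Cons.prems(1) by auto
    ultimately show ?thesis
      by (smt (verit) mult_nonpos_nonpos)
  qed
  have "w \<bullet> (P *v u) = 0" using adj[of w u] w[OF u] by (simp add: inner_commute)
  then have "v \<bullet> (P *v v) = u \<bullet> (P *v u) + w \<bullet> (P *v w)"
    using w[OF u] by (simp add: v matrix_vector_right_distrib inner_add_left inner_add_right)
  moreover have "0 < u \<bullet> (P *v u)" if "u \<noteq> 0"
    using Cons.IH[OF _ u that] Cons.prems(1) by simp
  ultimately show ?case
    using w_pos Cons.prems(3) v by (cases "u = 0"; cases "w = 0") auto
qed simp

lemma Lyapunov_pos_def:
  fixes A P :: "complex^'m^'m"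
  assumes "hurwitz A" and "hermitian P" and "conj_transpose A ** P + P ** A = - mat 1" and "v \<noteq> 0"
  shows "0 < v \<bullet> (P *v v)"
proof -
  obtain p where "p \<noteq> 0" "peval A p v = 0" using annihilating_polynomial_exists by blast
  then obtain ls where "\<forall>l\<in>set ls. eigenvalue A l" "v \<in> killed A ls"
    using killed_by_eigenvalues by blast
  then show ?thesis
    using assms by (intro Lyapunov_pos_on_killed[of P A ls]) (auto simp: hurwitz_def)
qed

text \<open>\<open>lambda_max\<close> is a \<open>Max\<close> over this set, which bounds the
  elements only if the set is finite. Eigenvectors of distinct eigenvalues are orthogonal, and an
  orthogonal set is finite.\<close>

lemma finite_real_eigenvalues:
  fixes P :: "complex^'m^'m"
  assumes "hermitian P"
  shows "finite {r. eigenvalue P (complex_of_real r)}"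
proof -
  define R where "R = {r. eigenvalue P (complex_of_real r)}"
  have "\<forall>r\<in>R. \<exists>v. v \<noteq> 0 \<and> P *v v = r *\<^sub>R v"
    unfolding R_def eigenvalue_def scaleR_eq_vector_scalar by blast
  then obtain e where e: "\<And>r. r \<in> R \<Longrightarrow> e r \<noteq> 0 \<and> P *v e r = r *\<^sub>R e r"
    by metis
  have orth: "e r \<bullet> e s = 0" if "r \<in> R" "s \<in> R" "r \<noteq> s" for r s
  proof -
    have "(P *v e r) \<bullet> e s = e r \<bullet> (P *v e s)"
      using assms by (simp add: inner_matrix_vector_mult hermitian_def)
    then show ?thesis using e that by simp
  qed
  have "pairwise orthogonal (e ` R)"
    using orth by (auto simp: pairwise_def orthogonal_def)
  then have "finite (e ` R)" by (rule pairwise_orthogonal_imp_finite)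
  moreover have "inj_on e R"
    using orth e by (metis inj_onI inner_eq_zero_iff)
  ultimately show ?thesis unfolding R_def by (rule finite_imageD)
qed

lemma inner_matrix_mult: "(M ** Z) \<bullet> W = Z \<bullet> (conj_transpose M ** W)"
  for M :: "complex^'n^'m" and Z :: "complex^'p^'n"
  by (simp add: inner_columns column_matrix_mult inner_matrix_vector_mult)

text \<open>The Rayleigh maximum of left multiplication by \<open>P\<close> is attained at an
  eigenmatrix, and any nonzero column of it is an eigenvector of \<open>P\<close> for the same real
  eigenvalue.\<close>

lemma lambda_max_bound:
  fixes P :: "complex^'m^'m" and Z :: "complex^'p^'m"
  assumes "hermitian P"
  shows "Z \<bullet> (P ** Z) \<le> lambda_max P * (Z \<bullet> Z)"
proof -
  have adj: "(P ** V) \<bullet> W = V \<bullet> (P ** W)" for V W :: "complex^'p^'m"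
    using assms by (simp add: inner_matrix_mult hermitian_def)
  obtain V :: "complex^'p^'m" and \<mu> where V: "V \<noteq> 0" "P ** V = \<mu> *\<^sub>R V"
    and \<mu>: "\<And>W :: complex^'p^'m. W \<bullet> (P ** W) \<le> \<mu> * (W \<bullet> W)"
    using Rayleigh_max[OF linear_matrix_mult adj] by blast
  obtain j where j: "column j V \<noteq> 0" using V(1) column_eq_0_imp_eq_0 by blast
  have "P *v column j V = complex_of_real \<mu> *s column j V"
    unfolding column_matrix_mult[symmetric] V(2)
    by (simp add: column_def vec_eq_iff scaleR_conv_of_real[where 'a = complex])
  then have "\<mu> \<in> {r. eigenvalue P (complex_of_real r)}"
    using j by (auto simp: eigenvalue_def)
  then have "\<mu> \<le> lambda_max P"
    unfolding lambda_max_def by (intro Max_ge finite_real_eigenvalues assms)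
  then show ?thesis using \<mu>[of Z] by (smt (verit) inner_ge_zero mult_right_mono)
qed

section \<open>Convergence of the observer\<close>

lemma Lyapunov_error_decay:
  fixes A P :: "complex^'m^'m" and e d :: "real \<Rightarrow> complex^'p^'m"
  assumes A: "hurwitz A" and P: "hermitian P" and Lyap: "conj_transpose A ** P + P ** A = - mat 1"
    and N: "0 < N" "2 * N * lambda_max P < 1"
    and cont: "continuous_on {0..} e"
    and deriv: "\<And>t. 0 < t \<Longrightarrow> (e has_vector_derivative A ** e t + d t) (at t)"
    and bound: "\<And>t. 0 < t \<Longrightarrow> norm (d t) \<le> N * norm (e t)"
  shows "(e \<longlongrightarrow> 0) at_top"
proof -
  define L where "L Z = P ** Z" for Z :: "complex^'p^'m"
  define \<Lambda> where "\<Lambda> = lambda_max P"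
  have L: "linear L" unfolding L_def by (rule linear_matrix_mult)
  have adj: "L Z \<bullet> W = Z \<bullet> L W" for Z W
    using P by (simp add: L_def inner_matrix_mult hermitian_def)
  have pos: "0 < Z \<bullet> L Z" if "Z \<noteq> 0" for Z
  proof -
    obtain j where "column j Z \<noteq> 0" using \<open>Z \<noteq> 0\<close> column_eq_0_imp_eq_0 by blast
    moreover have "0 \<le> column i Z \<bullet> (P *v column i Z)" for i
      using Lyapunov_pos_def[OF A P Lyap, of "column i Z"] by (cases "column i Z = 0") auto
    ultimately show ?thesis
      unfolding L_def inner_columns column_matrix_mult
      using Lyapunov_pos_def[OF A P Lyap] by (intro sum_pos2[of _ j]) auto
  qed
  then have psd: "0 \<le> Z \<bullet> L Z" for Z
    by (cases "Z = 0") (auto intro: less_imp_le)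
  have upper: "Z \<bullet> L Z \<le> \<Lambda> * (norm Z)\<^sup>2" for Z
    using lambda_max_bound[OF P, of Z] by (simp add: L_def \<Lambda>_def dot_square_norm)
  have "0 < \<Lambda>"
  proof -
    obtain b :: "complex^'p^'m" where "norm b = 1" using vector_choose_size[of 1] by auto
    moreover from this have "b \<noteq> 0" by auto
    ultimately show ?thesis using pos[of b] upper[of b] by simp
  qed
  \<comment> \<open>Applied to \<open>- L\<close>, the Rayleigh lemma yields the least eigenvalue
    \<open>\<mu>\<close> of \<open>L\<close>; positivity at its eigenvector gives
    \<open>0 < \<mu>\<close>, hence the lower bound of V by |e|^2.\<close>
  have "linear (\<lambda>Z. - L Z)" using L by (rule linear_compose_neg)
  moreover have "- L Z \<bullet> W = Z \<bullet> - L W" for Z W by (simp add: adj)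
  ultimately obtain v :: "complex^'p^'m" and \<nu> where v: "v \<noteq> 0" "- L v = \<nu> *\<^sub>R v"
    and \<nu>: "\<And>W. W \<bullet> - L W \<le> \<nu> * (W \<bullet> W)"
    using Rayleigh_max[of "\<lambda>Z. - L Z"] by blast
  define \<mu> where "\<mu> = - \<nu>"
  have "L v = \<mu> *\<^sub>R v" using v(2) by (simp add: \<mu>_def minus_equation_iff[of "L v"])
  then have "0 < \<mu>" using pos[OF v(1)] v(1) zero_less_mult_pos2[of \<mu> "v \<bullet> v"] by simp
  have lower: "\<mu> * (norm Z)\<^sup>2 \<le> Z \<bullet> L Z" for Z
    using \<nu>[of Z] by (simp add: \<mu>_def dot_square_norm)
  define V where "V t = e t \<bullet> L (e t)" for t
  \<comment> \<open>The rate results from V' \<le> -(1 - 2 N \<Lambda>) |e|^2 together with V \<le>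
    \<Lambda> |e|^2.\<close>
  define c where "c = (1 - 2 * N * \<Lambda>) / \<Lambda>"
  have "0 < c" using N(2) \<open>0 < \<Lambda>\<close> by (simp add: c_def \<Lambda>_def)
  have V_deriv: "\<exists>D. (V has_real_derivative D) (at t) \<and> D \<le> - c * V t" if t: "0 < t" for t
  proof -
    define e' where "e' = A ** e t + d t"
    have "(e has_derivative (\<lambda>h. h *\<^sub>R e')) (at t)"
      using deriv[OF t] by (simp add: has_vector_derivative_def e'_def)
    moreover from this have "((\<lambda>t. L (e t)) has_derivative (\<lambda>h. L (h *\<^sub>R e'))) (at t)"
      by (rule bounded_linear.has_derivative[OF L[unfolded linear_conv_bounded_linear]])
    ultimately have "(V has_derivative (\<lambda>h. e t \<bullet> L (h *\<^sub>R e') + h *\<^sub>R e' \<bullet> L (e t))) (at t)"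
      unfolding V_def by (rule has_derivative_inner)
    then have "(V has_real_derivative 2 * (e' \<bullet> L (e t))) (at t)"
      by (rule has_derivative_imp_has_field_derivative)
        (simp add: linear_scale[OF L] inner_commute[of "e t"] adj)
    moreover have "2 * ((A ** e t) \<bullet> L (e t)) = - (norm (e t))\<^sup>2"
    proof -
      have "2 * ((A ** e t) \<bullet> L (e t)) = (\<Sum>j\<in>UNIV. 2 * ((A *v column j (e t)) \<bullet> (P *v column j (e t))))"
        by (simp add: L_def inner_columns column_matrix_mult sum_distrib_left)
      also have "\<dots> = - (e t \<bullet> e t)"
        unfolding Lyapunov_inner[OF P Lyap] inner_columns[of "e t"] by (simp add: sum_negf)
      finally show ?thesis by (simp add: dot_square_norm)
    qed
    moreover have "d t \<bullet> L (e t) \<le> N * \<Lambda> * (norm (e t))\<^sup>2"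
    proof -
      \<comment> \<open>Cauchy-Schwarz for the form of \<open>P\<close> bounds the mixed term by two
        diagonal ones, each controlled by \<open>\<Lambda>\<close>; no operator norm of
        \<open>P\<close> enters.\<close>
      have "(d t \<bullet> L (e t))\<^sup>2 \<le> (d t \<bullet> L (d t)) * (e t \<bullet> L (e t))"
        by (rule psd_Cauchy_Schwarz[OF L adj psd])
      also have "\<dots> \<le> (\<Lambda> * (norm (d t))\<^sup>2) * (\<Lambda> * (norm (e t))\<^sup>2)"
        using upper psd \<open>0 < \<Lambda>\<close> by (intro mult_mono) auto
      also have "\<dots> \<le> (\<Lambda> * (N * norm (e t))\<^sup>2) * (\<Lambda> * (norm (e t))\<^sup>2)"
        using bound[OF t] \<open>0 < \<Lambda>\<close> by (intro mult_right_mono mult_left_mono power_mono) auto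
      also have "\<dots> = (N * \<Lambda> * (norm (e t))\<^sup>2)\<^sup>2"
        by (simp add: power2_eq_square mult_ac)
      finally show ?thesis
        by (rule power2_le_imp_le) (use N(1) \<open>0 < \<Lambda>\<close> in auto)
    qed
    moreover have "c * (\<Lambda> * (norm (e t))\<^sup>2) = (norm (e t))\<^sup>2 - 2 * (N * \<Lambda> * (norm (e t))\<^sup>2)"
      using \<open>0 < \<Lambda>\<close> by (simp add: c_def field_simps)
    moreover have "c * V t \<le> c * (\<Lambda> * (norm (e t))\<^sup>2)"
      using upper[of "e t"] \<open>0 < c\<close> by (simp add: V_def)
    ultimately show ?thesis
      by (intro exI[of _ "2 * (e' \<bullet> L (e t))"]) (simp add: e'_def inner_add_left)
  qed
  have V_cont: "continuous_on {0..t} V" for t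
    unfolding V_def
    by (intro continuous_intros continuous_on_compose2[OF linear_continuous_on[OF L[unfolded linear_conv_bounded_linear], of UNIV]]
        continuous_on_subset[OF cont]) auto
  have decay: "(norm (e t))\<^sup>2 \<le> V 0 / \<mu> * exp (- c * t)" if "0 \<le> t" for t
  proof -
    have "V t \<le> V 0 * exp (- c * (t - 0))"
      by (rule exponential_bound[OF that V_cont]) (use V_deriv in auto)
    then have "\<mu> * (norm (e t))\<^sup>2 \<le> V 0 * exp (- c * t)"
      using lower[of "e t"] by (simp add: V_def)
    then show ?thesis using \<open>0 < \<mu>\<close> by (simp add: field_simps)
  qed
  have "((\<lambda>t. V 0 / \<mu> * exp (- c * t)) \<longlongrightarrow> 0) at_top"
  proof (intro tendsto_mult_right_zero filterlim_compose[OF exp_at_bot])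
    show "LIM t at_top. - c * t :> at_bot"
      using \<open>0 < c\<close> by (intro filterlim_tendsto_neg_mult_at_bot[OF tendsto_const] filterlim_ident) simp
  qed
  moreover have "\<forall>\<^sub>F t in at_top. norm ((norm (e t))\<^sup>2) \<le> V 0 / \<mu> * exp (- c * t)"
    using eventually_ge_at_top[of 0] by eventually_elim (use decay in simp)
  ultimately have "((\<lambda>t. (norm (e t))\<^sup>2) \<longlongrightarrow> 0) at_top"
    by (rule Lim_null_comparison[rotated])
  then have "((\<lambda>t. sqrt ((norm (e t))\<^sup>2)) \<longlongrightarrow> sqrt 0) at_top" by (rule tendsto_real_sqrt)
  then show ?thesis by (simp add: tendsto_norm_zero_iff)
qed

section \<open>The modulus of injectivity and derivatives along trajectories\<close>

lemma class_K_inf_tendsto_0: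
  assumes "class_K_inf \<rho>" and "(r \<longlongrightarrow> 0) F" and "\<And>t. 0 \<le> r t"
  shows "((\<lambda>t. \<rho> (r t)) \<longlongrightarrow> 0) F"
proof -
  have "((\<lambda>t. \<rho> (r t)) \<longlongrightarrow> \<rho> 0) F"
    using assms by (intro continuous_on_tendsto_compose[of "{0..}" \<rho>]) (auto simp: class_K_inf_def)
  then show ?thesis using assms(1) by (simp add: class_K_inf_def)
qed

lemma class_K_inf_mono: "class_K_inf \<rho> \<Longrightarrow> 0 \<le> a \<Longrightarrow> a \<le> b \<Longrightarrow> \<rho> a \<le> \<rho> b"
  unfolding class_K_inf_def by (meson atLeast_iff order_trans strict_mono_on_leD)

text \<open>By the modulus \<open>\<rho>\<close>, preimages of a convergent sequence of images are
  Cauchy; their limit stays in \<open>C\<close> and is mapped to the limit of the images. Closedness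
  is what provides the nearest image used for \<open>Tstar\<close>.\<close>

lemma closed_class_K_inf_image:
  fixes T :: "'a::complete_space \<Rightarrow> 'b::real_normed_vector"
  assumes "closed C" and cont: "continuous_on C T" and \<rho>: "class_K_inf \<rho>"
    and bound: "\<And>x y. x \<in> C \<Longrightarrow> y \<in> C \<Longrightarrow> dist x y \<le> \<rho> (norm (T x - T y))"
  shows "closed (T ` C)"
  unfolding closed_sequential_limits
proof (intro allI impI, elim conjE)
  fix w l assume w: "\<forall>n. w n \<in> T ` C" and lim: "w \<longlonglongrightarrow> l"
  from w have "\<forall>n. \<exists>y. y \<in> C \<and> w n = T y" by blast
  then obtain x where x: "\<And>n. x n \<in> C" "\<And>n. w n = T (x n)" by metis
  have "Cauchy x"
  proof (rule metric_CauchyI)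
    fix \<epsilon> :: real assume "0 < \<epsilon>"
    have "continuous_on {0..} \<rho>" and "\<rho> 0 = 0" using \<rho> by (simp_all add: class_K_inf_def)
    then have "(\<rho> \<longlongrightarrow> 0) (at 0 within {0..})" by (metis atLeast_iff continuous_on_def order_refl)
    then have "\<forall>\<^sub>F r in at 0 within {0..}. \<rho> r < \<epsilon>"
      using \<open>0 < \<epsilon>\<close> by (rule order_tendstoD(2))
    then obtain \<delta> where "0 < \<delta>" "\<And>r. 0 < r \<Longrightarrow> r < \<delta> \<Longrightarrow> \<rho> r < \<epsilon>"
      by (auto simp: eventually_at dist_real_def)
    then have \<delta>: "0 < \<delta>" "\<And>r. 0 \<le> r \<Longrightarrow> r < \<delta> \<Longrightarrow> \<rho> r < \<epsilon>"
      using \<open>\<rho> 0 = 0\<close> \<open>0 < \<epsilon>\<close> by (auto simp: le_less)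
    have "Cauchy w" using lim by (rule LIMSEQ_imp_Cauchy)
    then obtain M where "\<And>m n. M \<le> m \<Longrightarrow> M \<le> n \<Longrightarrow> dist (w m) (w n) < \<delta>"
      using \<delta>(1) by (meson metric_CauchyD)
    then have "dist (x m) (x n) < \<epsilon>" if "M \<le> m" "M \<le> n" for m n
      using that bound[OF x(1) x(1), of m n] \<delta>(2)[of "norm (T (x m) - T (x n))"]
      by (simp add: x(2) dist_norm order_le_less_trans)
    then show "\<exists>M. \<forall>m\<ge>M. \<forall>n\<ge>M. dist (x m) (x n) < \<epsilon>" by blast
  qed
  then obtain y where y: "x \<longlonglongrightarrow> y" using Cauchy_convergent convergent_def by blast
  then have "y \<in> C" using \<open>closed C\<close> x(1) closed_sequentially by blast
  then have "(\<lambda>n. T (x n)) \<longlonglongrightarrow> T y"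
    using continuous_on_tendsto_compose[OF cont y] x(1) by simp
  then have "l = T y" using lim x(2) LIMSEQ_unique by (metis (no_types, lifting) ext)
  then show "l \<in> T ` C" using \<open>y \<in> C\<close> by blast
qed

text \<open>The Lie derivative at X(t) is taken along the flow started there, which is X(t + \<tau>)
  by translation. Its limit is two-sided, hence the interior time.\<close>

lemma has_lie_derivative_imp_has_vector_derivative:
  fixes f :: "'a::euclidean_space \<Rightarrow> 'a" and T :: "'a \<Rightarrow> 'b::real_normed_vector"
  assumes f: "locally_lipschitz f" and X: "solution_on f x J X" and t: "t \<in> interior J"
    and L: "has_lie_derivative f T (X t) L"
  shows "((\<lambda>s. T (X s)) has_vector_derivative L) (at t)"
proof -
  have "t \<in> J" using t interior_subset by blast
  obtain r where r: "0 < r" "ball t r \<subseteq> J" using t by (auto simp: mem_interior)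
  have flow: "flow f (X t) \<tau> = X (t + \<tau>)" if "\<bar>\<tau>\<bar> < r" for \<tau>
  proof -
    have "t + \<tau> \<in> J" using r(2) that by (auto simp: subset_iff dist_real_def)
    then have "\<tau> \<in> (\<lambda>s. s - t) ` J" by (intro image_eqI[of _ _ "t + \<tau>"]) auto
    then show ?thesis
      using flow_eq[OF f solution_on_shift[OF X \<open>t \<in> J\<close>]] by (simp add: add.commute)
  qed
  have lim: "((\<lambda>\<tau>. norm ((T (flow f (X t) \<tau>) - T (X t)) /\<^sub>R \<tau> - L)) \<longlongrightarrow> 0) (at 0)"
    using L unfolding has_lie_derivative_def by (intro tendsto_norm_zero) (simp add: LIM_zero_iff)
  have "((\<lambda>\<tau>. norm (T (X (t + \<tau>)) - T (X t) - \<tau> *\<^sub>R L) / norm \<tau>) \<longlongrightarrow> 0) (at 0)"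
  proof (rule Lim_transform_eventually[OF lim])
    have "norm ((T (flow f (X t) \<tau>) - T (X t)) /\<^sub>R \<tau> - L) =
        norm (T (X (t + \<tau>)) - T (X t) - \<tau> *\<^sub>R L) / norm \<tau>" if \<tau>: "\<tau> \<noteq> 0" "\<bar>\<tau>\<bar> < r" for \<tau>
    proof -
      have "(T (flow f (X t) \<tau>) - T (X t)) /\<^sub>R \<tau> - L = (T (X (t + \<tau>)) - T (X t) - \<tau> *\<^sub>R L) /\<^sub>R \<tau>"
        using \<tau> by (simp add: flow scaleR_diff_right)
      then show ?thesis by (simp add: divide_inverse_commute)
    qed
    then show "\<forall>\<^sub>F \<tau> in at 0. norm ((T (flow f (X t) \<tau>) - T (X t)) /\<^sub>R \<tau> - L) =
        norm (T (X (t + \<tau>)) - T (X t) - \<tau> *\<^sub>R L) / norm \<tau>"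
      unfolding eventually_at using r(1) by (intro exI[of _ r]) (auto simp: dist_real_def)
  qed
  then show ?thesis
    unfolding has_vector_derivative_def has_derivative_at by (simp add: bounded_linear_scaleR_left)
qed

theorem theorem2p10:
  fixes f :: "real^'n \<Rightarrow> real^'n"
    and h :: "real^'n \<Rightarrow> real^'p"
    and \<O> :: "(real^'n) set"
    and A P :: "complex^'m^'m"
    and Ta E :: "real^'n \<Rightarrow> complex^'p^'m"
    and B :: "real^'p \<Rightarrow> complex^'p^'m"
    and \<rho> :: "real \<Rightarrow> real"
    and N :: real
  assumes "locally_lipschitz f"
    and "locally_lipschitz h"
    and "open \<O>"
    and "\<O> \<noteq> {}"
    and "forward_complete_within f \<O>"
    and "hurwitz A"
    and "continuous_on (closure \<O>) Ta"
    and "continuous_on UNIV B"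
    and "class_K_inf \<rho>"
    and "\<forall>x1\<in>closure \<O>. \<forall>x2\<in>closure \<O>. norm (x1 - x2) \<le> \<rho> (norm (Ta x1 - Ta x2))"
    and "\<forall>x\<in>\<O>. \<exists>L. has_lie_derivative f Ta x L"
    and "\<forall>x\<in>\<O>. E x = lie_derivative f Ta x - (A ** Ta x + B (h x))"
    and "\<forall>x1\<in>closure \<O>. \<forall>x2\<in>closure \<O>. norm (E x1 - E x2) \<le> N * norm (Ta x1 - Ta x2)"
    and "0 < N"
    and "hermitian P"
    and "conj_transpose A ** P + P ** A = - mat 1"
    and "2 * N * lambda_max P < 1"
  shows "\<exists>(Tstar :: complex^'p^'m \<Rightarrow> real^'n) (F :: complex^'p^'m \<Rightarrow> complex^'p^'m).
    range Tstar \<subseteq> closure \<O> \<and> locally_lipschitz F \<and>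
    (\<forall>x\<in>\<O>. \<forall>z.
      let g = (\<lambda>(x, z). (f x, A ** z + F z + B (h x))) in
      (\<exists>b \<phi>. right_maximal_solution g (x, z) b \<phi>) \<and>
      (\<forall>b \<phi>. right_maximal_solution g (x, z) b \<phi> \<longrightarrow>
        b = sigma_plus f UNIV x \<and>
        (sigma_plus f \<O> x = sigma_plus f UNIV x \<longrightarrow>
          ((\<lambda>s. norm (Tstar (snd (\<phi> (real_of_ereal s))) - fst (\<phi> (real_of_ereal s)))) \<longlongrightarrow> 0)
            (at_left (sigma_plus f UNIV x)))))"
proof -
  note f = assms(1) and \<rho> = assms(9)
  define C where "C = closure \<O>"
  have OC: "\<O> \<subseteq> C" by (simp add: C_def closure_subset)
  have Ta_\<rho>: "norm (x - y) \<le> \<rho> (norm (Ta x - Ta y))" if "x \<in> C" "y \<in> C" for x y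
    using assms(10) that by (simp add: C_def)
  have E_lip: "norm (E x - E y) \<le> N * norm (Ta x - Ta y)" if "x \<in> C" "y \<in> C" for x y
    using assms(13) that by (simp add: C_def)
  have Ta_cont: "continuous_on C Ta" using assms(7) by (simp add: C_def)
  have inj: "inj_on Ta C"
    using Ta_\<rho> \<rho> by (fastforce simp: inj_on_def class_K_inf_def)

  have "N-lipschitz_on (Ta ` C) (\<lambda>w. E (inv_into C Ta w))"
    using E_lip inj \<open>0 < N\<close> by (intro lipschitz_onI) (auto simp: dist_norm)
  then obtain F where F: "N-lipschitz_on UNIV F"
    and "\<And>w. w \<in> Ta ` C \<Longrightarrow> F w = E (inv_into C Ta w)"
    using Kirszbraun by blast
  then have F_Ta: "F (Ta x) = E x" if "x \<in> C" for x
    using that inj by simp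
  have F_loc: "locally_lipschitz F"
    unfolding local_lipschitz_def using lipschitz_on_subset[OF F] by (metis subset_UNIV zero_less_one)

  have "closed (Ta ` C)"
    using Ta_cont \<rho> Ta_\<rho>
    by (intro closed_class_K_inf_image[where \<rho> = \<rho>]) (auto simp: C_def dist_norm)
  moreover have "Ta ` C \<noteq> {}" using OC assms(4) by blast
  ultimately have "\<exists>x\<in>C. infdist z (Ta ` C) = dist z (Ta x)" for z
    using infdist_attains_inf[of "Ta ` C" z] by blast
  then obtain Tstar where Ts: "\<And>z. Tstar z \<in> C"
    and near: "\<And>z. infdist z (Ta ` C) = dist z (Ta (Tstar z))"
    by metis
  have Ts_bound: "norm (Tstar z - x) \<le> \<rho> (2 * norm (z - Ta x))" if "x \<in> C" for x z
  proof -
    \<comment> \<open>Source of the factor 2: both \<open>Ta (Tstar z)\<close> and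
      \<open>Ta x\<close> lie within \<open>dist z (Ta x)\<close> of \<open>z\<close>.\<close>
    have "dist z (Ta (Tstar z)) \<le> dist z (Ta x)"
      unfolding near[symmetric] using that by (intro infdist_le) blast
    then have "norm (Ta (Tstar z) - Ta x) \<le> 2 * norm (z - Ta x)"
      using dist_triangle[of "Ta (Tstar z)" "Ta x" z] by (simp add: dist_commute flip: dist_norm)
    then have "\<rho> (norm (Ta (Tstar z) - Ta x)) \<le> \<rho> (2 * norm (z - Ta x))"
      by (intro class_K_inf_mono[OF \<rho>]) auto
    then show ?thesis using Ta_\<rho>[OF Ts that] by (rule order_trans[rotated])
  qed

  \<comment> \<open>Splits the Z-equation into a globally Lipschitz part and a forcing by x, the
    shape of the cascade lemmas.\<close>
  define G where "G z = A ** z + F z" for z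
  define k where "k x = B (h x)" for x
  obtain a where "a-lipschitz_on UNIV (\<lambda>z :: complex^'p^'m. A ** z)"
    using bounded_linear.lipschitz_boundE[OF linear_matrix_mult[unfolded linear_conv_bounded_linear]]
    by blast
  then have G: "(a + N)-lipschitz_on UNIV G"
    unfolding G_def using F by (rule lipschitz_on_add)
  have k: "continuous_on UNIV k"
    unfolding k_def
    by (rule continuous_on_compose2[OF assms(8) local_lipschitz_continuous_on[OF assms(2), of 0]]) auto

  have converges: "((\<lambda>s. norm (Tstar (snd (\<phi> (real_of_ereal s))) - fst (\<phi> (real_of_ereal s)))) \<longlongrightarrow> 0)
      (at_left (sigma_plus f UNIV x))"
    if x: "x \<in> \<O>" and sol: "right_maximal_solution (\<lambda>(x, z). (f x, G z + k x)) (x, z) b \<phi>"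
      and \<sigma>: "sigma_plus f \<O> x = sigma_plus f UNIV x" for x z b \<phi>
  proof -
    \<comment> \<open>Were the common value finite, forward completeness would make it smaller than
      itself.\<close>
    have inf: "sigma_plus f \<O> x = \<infinity>"
      using assms(5) x \<sigma> unfolding forward_complete_within_def by (metis ereal_infty_less(1) less_irrefl)
    then have "before b = {0..}"
      using cascade_maximal_solution_end[OF f G k sol] \<sigma> by (auto simp: before_iff)
    then have "solution_on (\<lambda>(x, z). (f x, G z + k x)) (x, z) {0..} \<phi>"
      using sol unfolding right_maximal_solution_def before_def[symmetric] by simp
    then have X: "solution_on f x {0..} (\<lambda>t. fst (\<phi> t))"
      and Z: "\<And>t. 0 \<le> t \<Longrightarrow>
        ((\<lambda>t. snd (\<phi> t)) has_vector_derivative G (snd (\<phi> t)) + k (fst (\<phi> t))) (at t within {0..})"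
      unfolding solution_on_cascade_iff by auto
    have XO: "fst (\<phi> t) \<in> \<O>" if "0 \<le> t" for t
      using flow_before_sigma_plus[OF f that, of \<O> x] flow_eq[OF f X, of t] that inf by simp
    define e where "e t = snd (\<phi> t) - Ta (fst (\<phi> t))" for t
    define d where "d t = F (snd (\<phi> t)) - F (Ta (fst (\<phi> t)))" for t
    have "(e \<longlongrightarrow> 0) at_top"
    proof (rule Lyapunov_error_decay[OF assms(6,15,16,14,17)])
      have "continuous_on {0..} (\<lambda>t. snd (\<phi> t))"
        by (rule continuous_on_vector_derivative[OF Z]) auto
      moreover have "continuous_on {0..} (\<lambda>t. Ta (fst (\<phi> t)))"
        by (rule continuous_on_compose2[OF Ta_cont solution_on_continuous[OF X]]) (use XO OC in auto)
      ultimately show "continuous_on {0..} e" unfolding e_def by (rule continuous_on_diff)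
    next
      fix t :: real assume t: "0 < t"
      obtain L where L: "has_lie_derivative f Ta (fst (\<phi> t)) L"
        using assms(11) XO[of t] t by auto
      then have "lie_derivative f Ta (fst (\<phi> t)) = L"
        unfolding has_lie_derivative_def lie_derivative_def by (intro tendsto_Lim) auto
      then have "L = E (fst (\<phi> t)) + (A ** Ta (fst (\<phi> t)) + B (h (fst (\<phi> t))))"
        using assms(12) XO[of t] t by simp
      \<comment> \<open>On the image of \<open>Ta\<close> the extension \<open>F\<close> takes the
        values of \<open>E\<close>, so Ta(X) has the right-hand side of the Z-equation and
        \<open>k\<close> cancels in the difference.\<close>
      then have L_eq: "L = A ** Ta (fst (\<phi> t)) + F (Ta (fst (\<phi> t))) + k (fst (\<phi> t))"
        using F_Ta[of "fst (\<phi> t)"] XO[of t] OC t by (auto simp: k_def)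
      have "t \<in> interior {0..}" using t by simp
      then have "((\<lambda>s. Ta (fst (\<phi> s))) has_vector_derivative L) (at t)"
        using has_lie_derivative_imp_has_vector_derivative[OF f X _ L] by blast
      moreover have "((\<lambda>s. snd (\<phi> s)) has_vector_derivative G (snd (\<phi> t)) + k (fst (\<phi> t))) (at t)"
        using Z[of t] t at_within_interior[of t "{0..}"] by simp
      ultimately have "(e has_vector_derivative G (snd (\<phi> t)) + k (fst (\<phi> t)) - L) (at t)"
        unfolding e_def by (intro has_vector_derivative_diff)
      moreover have "G (snd (\<phi> t)) + k (fst (\<phi> t)) - L = A ** e t + d t"
        by (simp add: L_eq G_def e_def d_def linear_diff[OF linear_matrix_mult])
      ultimately show "(e has_vector_derivative A ** e t + d t) (at t)" by simp
      show "norm (d t) \<le> N * norm (e t)"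
        using lipschitz_onD[OF F] by (simp add: d_def e_def dist_norm)
    qed
    then have "((\<lambda>t. 2 * norm (e t)) \<longlongrightarrow> 0) at_top"
      by (intro tendsto_mult_right_zero tendsto_norm_zero)
    then have "((\<lambda>t. \<rho> (2 * norm (e t))) \<longlongrightarrow> 0) at_top"
      by (intro class_K_inf_tendsto_0[OF \<rho>]) auto
    moreover have "norm (Tstar (snd (\<phi> t)) - fst (\<phi> t)) \<le> \<rho> (2 * norm (e t))" if "0 \<le> t" for t
      using Ts_bound[OF subsetD[OF OC XO[OF that]]] by (simp add: e_def)
    then have "\<forall>\<^sub>F t in at_top. norm (norm (Tstar (snd (\<phi> t)) - fst (\<phi> t))) \<le> \<rho> (2 * norm (e t))"
      by (intro eventually_mono[OF eventually_ge_at_top[of 0]]) simp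
    ultimately have "((\<lambda>t. norm (Tstar (snd (\<phi> t)) - fst (\<phi> t))) \<longlongrightarrow> 0) at_top"
      by (rule Lim_null_comparison[rotated])
    \<comment> \<open>The left neighbourhood filter of infinity is the image of
      \<open>at_top\<close> under \<open>ereal\<close>, which \<open>real_of_ereal\<close>
      undoes.\<close>
    then show ?thesis
      using inf \<sigma> by (simp add: at_left_PInf filterlim_filtermap)
  qed

  have g: "(\<lambda>(x, z). (f x, A ** z + F z + B (h x))) = (\<lambda>(x, z). (f x, G z + k x))"
    by (simp add: G_def k_def)
  show ?thesis
  proof (rule exI[of _ Tstar], rule exI[of _ F], unfold Let_def g, intro conjI ballI allI impI)
    show "range Tstar \<subseteq> closure \<O>" using Ts by (auto simp: C_def)
  next
    fix x z
    show "\<exists>b \<phi>. right_maximal_solution (\<lambda>(x, z). (f x, G z + k x)) (x, z) b \<phi>"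
      using cascade_maximal_solution_exists[OF f G k] by blast
  qed (use F_loc converges cascade_maximal_solution_end[OF f G k] in blast)+
qed

end
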